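(* In the realizability model $\mathcal{N}$, with $\mathcal{D}[\alpha]$ the formula expressing that the relation $\langle y<x\rangle\ge\alpha$ is well founded, the following are realized: (i) $\forall\alpha_0^{\beth2}\forall\alpha_1^{\beth2}\big(\alpha_0\wedge\alpha_1=0\hookrightarrow(\mathcal{D}[\alpha_0],\mathcal{D}[\alpha_1]\to\bot)\big)$; (ii) $\forall\alpha_0^{\beth2}\forall\alpha_1^{\beth2}\big(\mathcal{D}[\alpha_0],\mathcal{D}[\alpha_1]\to\mathcal{D}[\alpha_0\wedge\alpha_1]\big)$.
   Context: Classical realizability (Krivine): ground model $\mathcal{M}$ of ZF + V = L with a realizability algebra $(\Lambda,\Pi,\Lambda\star\Pi,\mathrm{QP},\perp\!\!\!\perp)$; $\mathcal{N}$ has the same individuals as $\mathcal{M}$; formulas of ZF$_\varepsilon$ (atomic $a\not\varepsilon b$, $a\notin b$, $a\subset b$, $\bot$; $\to,\forall$; function symbols defined in $\mathcal{M}$) get truth values $\|F\|\subseteq\Pi$ with $\|a\not\varepsilon b\|=\{\pi:(a,\pi)\in b\}$, $\|F\to G\|=\{\xi\cdot\pi:\xi\Vdash F,\pi\in\|G\|\}$, $\|\forall xF\|=\bigcup_a\|F[a]\|$, and $\xi\Vdash F$ iff $\xi\star\pi\in\perp\!\!\!\perp$ for all $\pi\in\|F\|$; "realized" means realized by a proof-like term. $F,G\to H$ abbreviates $F\to(G\to H)$. $\|R\hookrightarrow F\|=\|F\|$ if the $\mathcal{M}$-relation $R$ holds, $\emptyset$ otherwise. $\beth2=\{0,1\}\times\Pi$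 with Boolean operations extended from $\{0,1\}$; $\|\forall\alpha^{\beth2}F\|=\bigcup_{\alpha\in\{0,1\}}\|F[\alpha]\|$. $\langle y<x\rangle$ is the characteristic function of $y\in\mathrm{Cl}(x)$ in $\mathcal{M}$. $\mathcal{D}[\alpha]\equiv\forall X(\forall x(\forall y(\langle y<x\rangle\ge\alpha\hookrightarrow y\not\varepsilon X)\to x\not\varepsilon X)\to\forall x(x\not\varepsilon X))$. *)

theory Defs
  imports Main
begin

section \<open>Models of ZF + V = L\<close>

text \<open>
  A model is a type of individuals \<^typ>\<open>'m\<close> with a membership relation on it. Nothing makes that
  relation well founded outside the model. All quantifiers below that express a set-theoretic
  notion of the model therefore range over individuals, never over HOL sets of individuals.
\<close>

datatype fm = Mem nat nat | Eq nat nat | Neg fm | Conj fm fm | Forall nat fm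

primrec sat :: "('m \<Rightarrow> 'm \<Rightarrow> bool) \<Rightarrow> fm \<Rightarrow> (nat \<Rightarrow> 'm) \<Rightarrow> bool" where
  "sat mem (Mem i j) s \<longleftrightarrow> mem (s i) (s j)"
| "sat mem (Eq i j) s \<longleftrightarrow> s i = s j"
| "sat mem (Neg \<phi>) s \<longleftrightarrow> \<not> sat mem \<phi> s"
| "sat mem (Conj \<phi> \<psi>) s \<longleftrightarrow> sat mem \<phi> s \<and> sat mem \<psi> s"
| "sat mem (Forall i \<phi>) s \<longleftrightarrow> (\<forall>a. sat mem \<phi> (s(i := a)))"

context
  fixes mem :: "'m \<Rightarrow> 'm \<Rightarrow> bool"  (infix "\<^bold>\<in>" 50)
begin

text \<open>In both schemata the free variables of \<open>\<phi>\<close> other than 0 (and 1) are parameters.\<close>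

definition ZF_model :: bool where
  "ZF_model \<longleftrightarrow>
     (\<forall>a b. (\<forall>x. x \<^bold>\<in> a \<longleftrightarrow> x \<^bold>\<in> b) \<longrightarrow> a = b) \<and>
     (\<forall>a. (\<exists>x. x \<^bold>\<in> a) \<longrightarrow> (\<exists>x. x \<^bold>\<in> a \<and> \<not> (\<exists>y. y \<^bold>\<in> x \<and> y \<^bold>\<in> a))) \<and>
     (\<forall>a b. \<exists>c. \<forall>x. x \<^bold>\<in> c \<longleftrightarrow> x = a \<or> x = b) \<and>
     (\<forall>a. \<exists>u. \<forall>x. x \<^bold>\<in> u \<longleftrightarrow> (\<exists>y. y \<^bold>\<in> a \<and> x \<^bold>\<in> y)) \<and>
     (\<forall>a. \<exists>p. \<forall>x. x \<^bold>\<in> p \<longleftrightarrow> (\<forall>z. z \<^bold>\<in> x \<longrightarrow> z \<^bold>\<in> a)) \<and>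
     (\<exists>w. (\<exists>e. e \<^bold>\<in> w \<and> (\<forall>z. \<not> z \<^bold>\<in> e)) \<and>
          (\<forall>x. x \<^bold>\<in> w \<longrightarrow> (\<exists>y. y \<^bold>\<in> w \<and> (\<forall>z. z \<^bold>\<in> y \<longleftrightarrow> z \<^bold>\<in> x \<or> z = x)))) \<and>
     (\<forall>\<phi> s a. \<exists>b. \<forall>x. x \<^bold>\<in> b \<longleftrightarrow> x \<^bold>\<in> a \<and> sat mem \<phi> (s(0 := x))) \<and>
     (\<forall>\<phi> s a. (\<forall>x. x \<^bold>\<in> a \<longrightarrow> (\<exists>!y. sat mem \<phi> (s(0 := x, 1 := y)))) \<longrightarrow>
        (\<exists>b. \<forall>y. y \<^bold>\<in> b \<longleftrightarrow> (\<exists>x. x \<^bold>\<in> a \<and> sat mem \<phi> (s(0 := x, 1 := y)))))"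

subsection \<open>Sets of the model\<close>

text \<open>
  Only used for first-order conditions \<open>P\<close> whose extension is a set in every model of ZF.
\<close>

definition the_set :: "('m \<Rightarrow> bool) \<Rightarrow> 'm" where
  "the_set P = (THE a. \<forall>x. x \<^bold>\<in> a \<longleftrightarrow> P x)"

definition zero :: 'm where
  "zero = the_set (\<lambda>x. False)"

definition upair :: "'m \<Rightarrow> 'm \<Rightarrow> 'm" where
  "upair a b = the_set (\<lambda>x. x = a \<or> x = b)"

definition pair :: "'m \<Rightarrow> 'm \<Rightarrow> 'm" where
  "pair a b = upair (upair a a) (upair a b)"

definition succ :: "'m \<Rightarrow> 'm" where
  "succ a = the_set (\<lambda>x. x \<^bold>\<in> a \<or> x = a)"

definition one :: 'm where
  "one = succ zero"

definition two :: 'm where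
  "two = upair zero one"

definition subset :: "'m \<Rightarrow> 'm \<Rightarrow> bool" where
  "subset a b \<longleftrightarrow> (\<forall>x. x \<^bold>\<in> a \<longrightarrow> x \<^bold>\<in> b)"

definition transitive :: "'m \<Rightarrow> bool" where
  "transitive a \<longleftrightarrow> (\<forall>x. x \<^bold>\<in> a \<longrightarrow> subset x a)"

text \<open>\<open>Cl x\<close> is the least transitive set that includes \<open>x\<close>; thus \<open>x\<close> itself is not in \<open>Cl x\<close>.\<close>

definition Cl :: "'m \<Rightarrow> 'm" where
  "Cl x = the_set (\<lambda>y. \<forall>t. transitive t \<and> subset x t \<longrightarrow> y \<^bold>\<in> t)"

definition cartesian :: "'m \<Rightarrow> 'm \<Rightarrow> 'm" where
  "cartesian a b = the_set (\<lambda>p. \<exists>x y. x \<^bold>\<in> a \<and> y \<^bold>\<in> b \<and> p = pair x y)"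

definition is_fun :: "'m \<Rightarrow> 'm \<Rightarrow> 'm \<Rightarrow> bool" where
  "is_fun f a b \<longleftrightarrow>
     subset f (cartesian a b) \<and> (\<forall>x. x \<^bold>\<in> a \<longrightarrow> (\<exists>!y. pair x y \<^bold>\<in> f))"

definition fapply :: "'m \<Rightarrow> 'm \<Rightarrow> 'm" where
  "fapply f x = (THE y. pair x y \<^bold>\<in> f)"

definition fupdate :: "'m \<Rightarrow> 'm \<Rightarrow> 'm \<Rightarrow> 'm" where
  "fupdate f x y =
     the_set (\<lambda>p. (p \<^bold>\<in> f \<and> (\<forall>z. p \<noteq> pair x z)) \<or> p = pair x y)"

definition is_ordinal :: "'m \<Rightarrow> bool" where
  "is_ordinal a \<longleftrightarrow> transitive a \<and> (\<forall>x. x \<^bold>\<in> a \<longrightarrow> transitive x)"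

definition is_limit :: "'m \<Rightarrow> bool" where
  "is_limit a \<longleftrightarrow> is_ordinal a \<and> a \<noteq> zero \<and> (\<forall>x. a \<noteq> succ x)"

definition omega :: 'm where
  "omega = the_set (\<lambda>n. \<forall>w. zero \<^bold>\<in> w \<and> (\<forall>x. x \<^bold>\<in> w \<longrightarrow> succ x \<^bold>\<in> w) \<longrightarrow> n \<^bold>\<in> w)"

subsection \<open>Constructibility\<close>

text \<open>
  The relations on assignments \<open>s : omega \<rightarrow> A\<close> that are defined over \<open>(A, \<in>)\<close> by the formulas
  in the sense of the model form the least family containing the atomic relations and closed under
  complement, intersection and existential quantification of a variable.
\<close>

definition definable_family :: "'m \<Rightarrow> 'm \<Rightarrow> bool" where
  "definable_family A F \<longleftrightarrow>
     (\<forall>i j. i \<^bold>\<in> omega \<and> j \<^bold>\<in> omega \<longrightarrow>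
        the_set (\<lambda>s. is_fun s omega A \<and> fapply s i \<^bold>\<in> fapply s j) \<^bold>\<in> F \<and>
        the_set (\<lambda>s. is_fun s omega A \<and> fapply s i = fapply s j) \<^bold>\<in> F) \<and>
     (\<forall>R. R \<^bold>\<in> F \<longrightarrow> the_set (\<lambda>s. is_fun s omega A \<and> \<not> s \<^bold>\<in> R) \<^bold>\<in> F) \<and>
     (\<forall>R S. R \<^bold>\<in> F \<and> S \<^bold>\<in> F \<longrightarrow> the_set (\<lambda>s. s \<^bold>\<in> R \<and> s \<^bold>\<in> S) \<^bold>\<in> F) \<and>
     (\<forall>R i. R \<^bold>\<in> F \<and> i \<^bold>\<in> omega \<longrightarrow>
        the_set (\<lambda>s. is_fun s omega A \<and> (\<exists>a. a \<^bold>\<in> A \<and> fupdate s i a \<^bold>\<in> R)) \<^bold>\<in> F)"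

definition definable_relation :: "'m \<Rightarrow> 'm \<Rightarrow> bool" where
  "definable_relation A R \<longleftrightarrow> (\<forall>F. definable_family A F \<longrightarrow> R \<^bold>\<in> F)"

text \<open>
  The set of the subsets of \<open>A\<close> definable over \<open>(A, \<in>)\<close> with parameters in \<open>A\<close>. The disjunct
  \<open>X = zero\<close> matters only for empty \<open>A\<close>, where there are no assignments.
\<close>

definition Def :: "'m \<Rightarrow> 'm" where
  "Def A = the_set (\<lambda>X. subset X A \<and>
     (X = zero \<or>
      (\<exists>R s. definable_relation A R \<and> is_fun s omega A \<and>
         (\<forall>a. a \<^bold>\<in> X \<longleftrightarrow> a \<^bold>\<in> A \<and> fupdate s zero a \<^bold>\<in> R))))"

text \<open>\<open>f\<close> is the sequence of the levels \<open>L\<^sub>\<beta>\<close> for \<open>\<beta> \<le> \<alpha>\<close>.\<close>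

definition is_L_hierarchy :: "'m \<Rightarrow> 'm \<Rightarrow> bool" where
  "is_L_hierarchy \<alpha> f \<longleftrightarrow>
     (\<exists>B. is_fun f (succ \<alpha>) B) \<and>
     fapply f zero = zero \<and>
     (\<forall>\<beta>. \<beta> \<^bold>\<in> \<alpha> \<longrightarrow> fapply f (succ \<beta>) = Def (fapply f \<beta>)) \<and>
     (\<forall>\<beta>. \<beta> \<^bold>\<in> succ \<alpha> \<and> is_limit \<beta> \<longrightarrow>
        fapply f \<beta> = the_set (\<lambda>x. \<exists>\<gamma>. \<gamma> \<^bold>\<in> \<beta> \<and> x \<^bold>\<in> fapply f \<gamma>))"

definition constructible :: "'m \<Rightarrow> bool" where
  "constructible x \<longleftrightarrow>
     (\<exists>\<alpha> f. is_ordinal \<alpha> \<and> is_L_hierarchy \<alpha> f \<and> x \<^bold>\<in> fapply f \<alpha>)"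

definition ZFL_model :: bool where
  "ZFL_model \<longleftrightarrow> ZF_model \<and> (\<forall>x. constructible x)"

subsection \<open>Functions defined in the model\<close>

text \<open>
  The Boolean operation is the one of \<open>{0, 1}\<close>; its values outside \<open>{0, 1}\<close> are irrelevant.
\<close>

definition band :: "'m \<Rightarrow> 'm \<Rightarrow> 'm" where
  "band a b = (if a = one \<and> b = one then one else zero)"

definition bge :: "'m \<Rightarrow> 'm \<Rightarrow> bool" where
  "bge a b \<longleftrightarrow> band a b = b"

definition char_less :: "'m \<Rightarrow> 'm \<Rightarrow> 'm" where
  "char_less y x = (if y \<^bold>\<in> Cl x then one else zero)"

end

section \<open>Realizability algebras\<close>

text \<open>
  All components are individuals of the model: \<open>Lam\<close>, \<open>Stk\<close>, \<open>Proc\<close>, \<open>QP\<close> and \<open>Pole\<close> are the sets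
  \<open>\<Lambda>\<close>, \<open>\<Pi>\<close>, \<open>\<Lambda>\<star>\<Pi>\<close>, of proof-like terms, and \<open>\<bottom>\<bottom>\<close>; \<open>App\<close>, \<open>Push\<close>, \<open>Cut\<close> and \<open>Cont\<close> are
  the functions (as sets of pairs) for application, push, process formation and continuation.
\<close>

record 'm ralg =
  Lam :: 'm
  Stk :: 'm
  Proc :: 'm
  QP :: 'm
  Pole :: 'm
  App :: 'm
  Push :: 'm
  Cut :: 'm
  Cont :: 'm
  cB :: 'm
  cC :: 'm
  cE :: 'm
  cI :: 'm
  cK :: 'm
  cW :: 'm
  cc :: 'm

text \<open>
  Formulas of ZF\<open>\<^sub>\<epsilon>\<close> with individuals as parameters; a quantifier is given by the family of
  its instances. \<open>AllGimel E F\<close> is the quantifier restricted to the type \<open>\<gimel>E = E \<times> \<Pi>\<close>.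
\<close>

datatype 'm form =
    NotEps 'm 'm
  | Falsum
  | Imp "'m form" "'m form"  (infixr "\<^bold>\<rightarrow>" 25)
  | All "'m \<Rightarrow> 'm form"
  | AllGimel 'm "'m \<Rightarrow> 'm form"
  | Hook bool "'m form"  (infixr "\<^bold>\<hookrightarrow>" 25)

context
  fixes mem :: "'m \<Rightarrow> 'm \<Rightarrow> bool"  (infix "\<^bold>\<in>" 50)
    and \<A> :: "'m ralg"
begin

definition app :: "'m \<Rightarrow> 'm \<Rightarrow> 'm"  (infixl "\<^bold>\<cdot>" 75) where
  "\<xi> \<^bold>\<cdot> \<eta> = fapply mem (App \<A>) (pair mem \<xi> \<eta>)"

definition push :: "'m \<Rightarrow> 'm \<Rightarrow> 'm"  (infixr "\<^bold>#" 70) where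
  "\<xi> \<^bold># \<pi> = fapply mem (Push \<A>) (pair mem \<xi> \<pi>)"

definition cut :: "'m \<Rightarrow> 'm \<Rightarrow> 'm"  (infix "\<^bold>\<star>" 65) where
  "\<xi> \<^bold>\<star> \<pi> = fapply mem (Cut \<A>) (pair mem \<xi> \<pi>)"

definition cont :: "'m \<Rightarrow> 'm" where
  "cont \<pi> = fapply mem (Cont \<A>) \<pi>"

text \<open>
  The preorder \<open>exec\<^sup>*\<^sup>*\<close> is formed outside the model. For the pole this makes no difference:
  a set of the model is closed under it, or under its counterpart in the model, if and only if it is
  closed under \<open>exec\<close>.
\<close>

inductive exec :: "'m \<Rightarrow> 'm \<Rightarrow> bool" where
  exec_app: "\<lbrakk>\<xi> \<^bold>\<in> Lam \<A>; \<eta> \<^bold>\<in> Lam \<A>; \<pi> \<^bold>\<in> Stk \<A>\<rbrakk> \<Longrightarrow>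
    exec ((\<xi> \<^bold>\<cdot> \<eta>) \<^bold>\<star> \<pi>) (\<xi> \<^bold>\<star> (\<eta> \<^bold># \<pi>))"
| exec_I: "\<lbrakk>\<xi> \<^bold>\<in> Lam \<A>; \<pi> \<^bold>\<in> Stk \<A>\<rbrakk> \<Longrightarrow>
    exec (cI \<A> \<^bold>\<star> (\<xi> \<^bold># \<pi>)) (\<xi> \<^bold>\<star> \<pi>)"
| exec_K: "\<lbrakk>\<xi> \<^bold>\<in> Lam \<A>; \<eta> \<^bold>\<in> Lam \<A>; \<pi> \<^bold>\<in> Stk \<A>\<rbrakk> \<Longrightarrow>
    exec (cK \<A> \<^bold>\<star> (\<xi> \<^bold># \<eta> \<^bold># \<pi>)) (\<xi> \<^bold>\<star> \<pi>)"
| exec_E: "\<lbrakk>\<xi> \<^bold>\<in> Lam \<A>; \<eta> \<^bold>\<in> Lam \<A>; \<pi> \<^bold>\<in> Stk \<A>\<rbrakk> \<Longrightarrow>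
    exec (cE \<A> \<^bold>\<star> (\<xi> \<^bold># \<eta> \<^bold># \<pi>)) ((\<xi> \<^bold>\<cdot> \<eta>) \<^bold>\<star> \<pi>)"
| exec_W: "\<lbrakk>\<xi> \<^bold>\<in> Lam \<A>; \<eta> \<^bold>\<in> Lam \<A>; \<pi> \<^bold>\<in> Stk \<A>\<rbrakk> \<Longrightarrow>
    exec (cW \<A> \<^bold>\<star> (\<xi> \<^bold># \<eta> \<^bold># \<pi>)) (\<xi> \<^bold>\<star> (\<eta> \<^bold># \<eta> \<^bold># \<pi>))"
| exec_C: "\<lbrakk>\<xi> \<^bold>\<in> Lam \<A>; \<eta> \<^bold>\<in> Lam \<A>; \<zeta> \<^bold>\<in> Lam \<A>; \<pi> \<^bold>\<in> Stk \<A>\<rbrakk> \<Longrightarrow>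
    exec (cC \<A> \<^bold>\<star> (\<xi> \<^bold># \<eta> \<^bold># \<zeta> \<^bold># \<pi>)) (\<xi> \<^bold>\<star> (\<zeta> \<^bold># \<eta> \<^bold># \<pi>))"
| exec_B: "\<lbrakk>\<xi> \<^bold>\<in> Lam \<A>; \<eta> \<^bold>\<in> Lam \<A>; \<zeta> \<^bold>\<in> Lam \<A>; \<pi> \<^bold>\<in> Stk \<A>\<rbrakk> \<Longrightarrow>
    exec (cB \<A> \<^bold>\<star> (\<xi> \<^bold># \<eta> \<^bold># \<zeta> \<^bold># \<pi>)) ((\<xi> \<^bold>\<cdot> (\<eta> \<^bold>\<cdot> \<zeta>)) \<^bold>\<star> \<pi>)"
| exec_cc: "\<lbrakk>\<xi> \<^bold>\<in> Lam \<A>; \<pi> \<^bold>\<in> Stk \<A>\<rbrakk> \<Longrightarrow>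
    exec (cc \<A> \<^bold>\<star> (\<xi> \<^bold># \<pi>)) (\<xi> \<^bold>\<star> (cont \<pi> \<^bold># \<pi>))"
| exec_cont: "\<lbrakk>\<xi> \<^bold>\<in> Lam \<A>; \<pi> \<^bold>\<in> Stk \<A>; \<rho> \<^bold>\<in> Stk \<A>\<rbrakk> \<Longrightarrow>
    exec (cont \<pi> \<^bold>\<star> (\<xi> \<^bold># \<rho>)) (\<xi> \<^bold>\<star> \<pi>)"

definition realizability_algebra :: bool where
  "realizability_algebra \<longleftrightarrow>
     is_fun mem (App \<A>) (cartesian mem (Lam \<A>) (Lam \<A>)) (Lam \<A>) \<and>
     is_fun mem (Push \<A>) (cartesian mem (Lam \<A>) (Stk \<A>)) (Stk \<A>) \<and>
     is_fun mem (Cut \<A>) (cartesian mem (Lam \<A>) (Stk \<A>)) (Proc \<A>) \<and>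
     is_fun mem (Cont \<A>) (Stk \<A>) (Lam \<A>) \<and>
     subset mem (Pole \<A>) (Proc \<A>) \<and>
     (\<forall>p q. exec\<^sup>*\<^sup>* p q \<and> q \<^bold>\<in> Pole \<A> \<longrightarrow> p \<^bold>\<in> Pole \<A>) \<and>
     subset mem (QP \<A>) (Lam \<A>) \<and>
     (\<forall>c \<in> {cB \<A>, cC \<A>, cE \<A>, cI \<A>, cK \<A>, cW \<A>, cc \<A>}. c \<^bold>\<in> QP \<A>) \<and>
     (\<forall>\<xi> \<eta>. \<xi> \<^bold>\<in> QP \<A> \<and> \<eta> \<^bold>\<in> QP \<A> \<longrightarrow> (\<xi> \<^bold>\<cdot> \<eta>) \<^bold>\<in> QP \<A>)"

primrec truth_value :: "'m form \<Rightarrow> 'm set" where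
  "truth_value (NotEps a b) = {\<pi>. \<pi> \<^bold>\<in> Stk \<A> \<and> pair mem a \<pi> \<^bold>\<in> b}"
| "truth_value Falsum = {\<pi>. \<pi> \<^bold>\<in> Stk \<A>}"
| "truth_value (F \<^bold>\<rightarrow> G) =
     {\<xi> \<^bold># \<pi> | \<xi> \<pi>. \<xi> \<^bold>\<in> Lam \<A> \<and> (\<forall>\<rho> \<in> truth_value F. (\<xi> \<^bold>\<star> \<rho>) \<^bold>\<in> Pole \<A>) \<and>
                      \<pi> \<in> truth_value G}"
| "truth_value (All F) = (\<Union>a. truth_value (F a))"
| "truth_value (AllGimel E F) = (\<Union>a \<in> {a. a \<^bold>\<in> E}. truth_value (F a))"
| "truth_value (R \<^bold>\<hookrightarrow> F) = (if R then truth_value F else {})"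

definition realizes :: "'m \<Rightarrow> 'm form \<Rightarrow> bool"  (infix "\<^bold>\<tturnstile>" 50) where
  "\<xi> \<^bold>\<tturnstile> F \<longleftrightarrow> \<xi> \<^bold>\<in> Lam \<A> \<and> (\<forall>\<pi> \<in> truth_value F. (\<xi> \<^bold>\<star> \<pi>) \<^bold>\<in> Pole \<A>)"

definition realized :: "'m form \<Rightarrow> bool" where
  "realized F \<longleftrightarrow> (\<exists>\<theta>. \<theta> \<^bold>\<in> QP \<A> \<and> \<theta> \<^bold>\<tturnstile> F)"

end

definition D :: "('m \<Rightarrow> 'm \<Rightarrow> bool) \<Rightarrow> 'm \<Rightarrow> 'm form" where
  "D mem \<alpha> =
     All (\<lambda>X.
       All (\<lambda>x. All (\<lambda>y. bge mem (char_less mem y x) \<alpha> \<^bold>\<hookrightarrow> NotEps y X) \<^bold>\<rightarrow> NotEps x X)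
       \<^bold>\<rightarrow> All (\<lambda>x. NotEps x X))"

end

theory Submission
  imports Defs
begin

text \<open>
  One proof-like term \<open>\<lambda>\<xi>\<^sub>0 \<xi>\<^sub>1 \<eta>. \<xi>\<^sub>1 (\<lambda>m v. \<eta> (v m)) (\<xi>\<^sub>0 (\<lambda>v l. l v))\<close> realizes (ii), and applying it to
  \<open>\<eta> = I\<close> gives (i), since \<open>D[0]\<close> is refuted by any constant family of truth values. That the term
  works for all four values of \<open>(\<alpha>\<^sub>0, \<alpha>\<^sub>1)\<close> is checked in the ground model with truth values chosen
  separately in each case. Let \<open>\<Phi> U A = (A \<rightarrow> U) \<rightarrow> U\<close>.

  If \<open>\<alpha>\<^sub>0 = \<alpha>\<^sub>1 = 1\<close>, let \<open>P x = (\<Union>y\<in>Cl x. \<Phi> (X y) (P y))\<close>, where \<open>X x\<close> is the truth value to be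
  realized; then \<open>\<xi>\<^sub>0 (\<lambda>v l. l v)\<close> realizes every \<open>\<Phi> (X x) (P x)\<close>, hence \<open>P x\<close>, and
  \<open>\<xi>\<^sub>1 (\<lambda>m v. \<eta> (v m))\<close> realizes every \<open>P x \<rightarrow> X x\<close>.

  Otherwise \<open>\<eta>\<close> realizes \<open>U \<rightarrow> U\<close> for the union \<open>U\<close> of all the \<open>X x\<close>. The increasing sequence
  \<open>P y = (\<Union>y'\<in>y. \<Phi> U (P y'))\<close>, for ordinals \<open>y\<close>, becomes stationary by Replacement at some
  \<open>W = \<Phi> U W\<close>. Now \<open>D[1]\<close> gives induction along this sequence, \<open>D[0]\<close> gives \<open>(A \<rightarrow> A) \<rightarrow> A\<close> for all \<open>A\<close>,
  and the two inner terms realize \<open>W\<close> and \<open>W \<rightarrow> U\<close>, in the order determined by which \<open>\<alpha>\<^sub>i\<close> is \<open>0\<close>.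

  The \<open>X\<close> in \<open>D[\<alpha>]\<close> ranges over individuals only, so all these families have to be definable in the
  ground model.
\<close>

section \<open>Definable predicates\<close>

primrec rename :: "(nat \<Rightarrow> nat) \<Rightarrow> fm \<Rightarrow> fm" where
  "rename f (Mem i j) = Mem (f i) (f j)"
| "rename f (Eq i j) = Eq (f i) (f j)"
| "rename f (Neg \<phi>) = Neg (rename f \<phi>)"
| "rename f (Conj \<phi> \<psi>) = Conj (rename f \<phi>) (rename f \<psi>)"
| "rename f (Forall i \<phi>) = Forall (f i) (rename f \<phi>)"

text \<open>Injectivity keeps a renamed bound variable from capturing another one: updating at
  \<open>f i\<close> changes the composite with \<open>f\<close> at \<open>i\<close> only.\<close>

lemma sat_rename:
  assumes "inj f"
  shows "sat mem (rename f \<phi>) s \<longleftrightarrow> sat mem \<phi> (s \<circ> f)"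
proof (induction \<phi> arbitrary: s)
  case (Forall i \<phi>)
  have "s(f i := a) \<circ> f = (s \<circ> f)(i := a)" for a
    using assms by (auto simp: inj_eq)
  then show ?case by (simp only: rename.simps sat.simps Forall)
qed auto

text \<open>
  The even variables of a formula hold an environment in de Bruijn style, the odd ones parameters.
\<close>

definition comb :: "(nat \<Rightarrow> 'm) \<Rightarrow> (nat \<Rightarrow> 'm) \<Rightarrow> nat \<Rightarrow> 'm" where
  "comb e p n = (if even n then e (n div 2) else p (n div 2))"

lemma comb_simps [simp]:
  "comb e p (2 * n) = e n" "comb e p (Suc (2 * n)) = p n"
  by (simp_all add: comb_def)

lemma comp_comb: "f \<circ> comb e p = comb (f \<circ> e) (f \<circ> p)"
  by (auto simp: comb_def)

lemma inj_comb:
  assumes "inj e" "inj p" "\<And>i j. e i \<noteq> p j"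
  shows "inj (comb e p)"
proof (rule injI)
  fix m n assume eq: "comb e p m = comb e p n"
  have "m mod 2 = n mod 2 \<and> m div 2 = n div 2"
  proof (cases "even m"; cases "even n")
    assume "even m" "even n"
    then show ?thesis using eq injD[OF assms(1)] by (simp add: comb_def mod2_eq_if)
  next
    assume "odd m" "odd n"
    then show ?thesis using eq injD[OF assms(2)] by (simp add: comb_def mod2_eq_if)
  qed (use eq assms(3) in \<open>simp_all add: comb_def, metis\<close>)
  then show "m = n"
    by (metis div_mult_mod_eq)
qed

text \<open>The parameter sequence \<open>p\<close> is chosen once for all environments. Predicates
  of whole environments let one set of rules serve every number of variables.\<close>

definition definable :: "('m \<Rightarrow> 'm \<Rightarrow> bool) \<Rightarrow> ((nat \<Rightarrow> 'm) \<Rightarrow> bool) \<Rightarrow> bool" where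
  "definable mem F \<longleftrightarrow> (\<exists>\<phi> p. \<forall>e. F e \<longleftrightarrow> sat mem \<phi> (comb e p))"

text \<open>A function on environments need not be a term of the language, so its graph is required
  to be definable, with the value in place 0 in front of the arguments.\<close>

definition definable_term :: "('m \<Rightarrow> 'm \<Rightarrow> bool) \<Rightarrow> ((nat \<Rightarrow> 'm) \<Rightarrow> 'm) \<Rightarrow> bool" where
  "definable_term mem t \<longleftrightarrow> definable mem (\<lambda>e. e 0 = t (\<lambda>i. e (Suc i)))"

text \<open>The values are HOL sets and need not be individuals; only membership in them has to be
  definable.\<close>

definition definable_class :: "('m \<Rightarrow> 'm \<Rightarrow> bool) \<Rightarrow> ((nat \<Rightarrow> 'm) \<Rightarrow> 'm set) \<Rightarrow> bool" where
  "definable_class mem A \<longleftrightarrow> definable mem (\<lambda>e. e 0 \<in> A (\<lambda>i. e (Suc i)))"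

named_theorems definable_intros

section \<open>Closure of definability under connectives and quantifiers\<close>

lemma definable_mem_var: "definable mem (\<lambda>e. mem (e i) (e j))"
  unfolding definable_def
  by (intro exI[of _ "Mem (2 * i) (2 * j)"]) (simp add: comb_def)

lemma definable_eq_var: "definable mem (\<lambda>e. e i = e j)"
  unfolding definable_def
  by (intro exI[of _ "Eq (2 * i) (2 * j)"]) (simp add: comb_def)

lemma definable_eq_const: "definable mem (\<lambda>e. e i = c)"
  unfolding definable_def
  by (intro exI[of _ "Eq (2 * i) 1"] exI[of _ "\<lambda>_. c"]) (simp add: comb_def)

lemma definable_not [definable_intros]:
  assumes "definable mem F" shows "definable mem (\<lambda>e. \<not> F e)"
proof -
  obtain \<phi> p where "\<forall>e. F e \<longleftrightarrow> sat mem \<phi> (comb e p)"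
    using assms unfolding definable_def by blast
  then show ?thesis
    unfolding definable_def by (intro exI[of _ "Neg \<phi>"] exI[of _ p]) simp
qed

lemma definable_conj [definable_intros]:
  assumes "definable mem F" "definable mem G" shows "definable mem (\<lambda>e. F e \<and> G e)"
proof -
  obtain \<phi> p \<psi> q where F: "\<forall>e. F e \<longleftrightarrow> sat mem \<phi> (comb e p)"
    and G: "\<forall>e. G e \<longleftrightarrow> sat mem \<psi> (comb e q)"
    using assms unfolding definable_def by blast
  \<comment> \<open>The two parameter sequences are interleaved: those of \<open>F\<close> go to the
    even-numbered parameter places, those of \<open>G\<close> to the odd-numbered ones. The
    environment stays in place.\<close>
  let ?f = "comb (\<lambda>n. 2 * n) (\<lambda>n. Suc (2 * (2 * n)))"
  let ?g = "comb (\<lambda>n. 2 * n) (\<lambda>n. Suc (2 * Suc (2 * n)))"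
  have f: "inj ?f" by (rule inj_comb) (simp_all only: inj_def Suc_double_not_eq_double double_not_eq_Suc_double not_False_eq_True, simp_all)
  have g: "inj ?g" by (rule inj_comb) (simp_all only: inj_def Suc_double_not_eq_double double_not_eq_Suc_double not_False_eq_True, simp_all)
  have "comb e (comb p q) \<circ> ?f = comb e p" "comb e (comb p q) \<circ> ?g = comb e q" for e
    by (simp_all only: comp_comb) (simp_all only: comp_def comb_simps)
  then show ?thesis
    unfolding definable_def using F G
    by (intro exI[of _ "Conj (rename ?f \<phi>) (rename ?g \<psi>)"] exI[of _ "comb p q"])
      (simp only: simp_thms sat.simps sat_rename[OF f] sat_rename[OF g])
qed

lemma definable_all [definable_intros]:
  assumes "definable mem (\<lambda>e. F (e 0) (\<lambda>i. e (Suc i)))"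
  shows "definable mem (\<lambda>e. \<forall>a. F a e)"
proof -
  obtain \<phi> p where F: "\<forall>e. F (e 0) (\<lambda>i. e (Suc i)) \<longleftrightarrow> sat mem \<phi> (comb e p)"
    using assms unfolding definable_def by blast
  have *: "F a e \<longleftrightarrow> sat mem \<phi> (comb (case_nat a e) p)" for a e
    using spec[OF F, of "case_nat a e"] by simp
  \<comment> \<open>The bound variable moves to variable 3, which is parameter place 1. The old
    parameters go to the even-numbered parameter places and so leave it free, and the rest of the
    environment moves down by one.\<close>
  let ?r = "comb (case_nat 3 (\<lambda>n. 2 * n)) (\<lambda>n. Suc (2 * (2 * n)))"
  let ?p = "comb p p"
  have neq: "2 * m \<noteq> (3::nat)" "Suc (4 * m) \<noteq> 3" "2 * m \<noteq> Suc (4 * n)" for m n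
    by arith+
  have r: "inj ?r"
  proof (rule inj_comb)
    show "inj (case_nat 3 (\<lambda>n::nat. 2 * n))"
      using neq by (simp add: inj_def split: nat.split)
    show "inj (\<lambda>n::nat. Suc (2 * (2 * n)))"
      by (simp add: inj_def)
    show "case_nat 3 (\<lambda>n::nat. 2 * n) i \<noteq> Suc (2 * (2 * j))" for i j
      using neq by (simp split: nat.split)
  qed
  have "(comb e ?p)(3 := a) \<circ> ?r = comb (case_nat a e) p" for e a
    unfolding comp_comb
  proof (rule arg_cong2[where f = comb])
    show "(comb e ?p)(3 := a) \<circ> case_nat 3 (\<lambda>n. 2 * n) = case_nat a e"
      using neq by (auto simp: fun_eq_iff split: nat.splits)
    show "(comb e ?p)(3 := a) \<circ> (\<lambda>n. Suc (2 * (2 * n))) = p"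
      using neq(2) by (simp only: comp_def fun_upd_apply comb_simps fun_eq_iff) simp
  qed
  then show ?thesis
    unfolding definable_def using *
    by (intro exI[of _ "Forall 3 (rename ?r \<phi>)"] exI[of _ ?p]) (simp only: simp_thms sat.simps sat_rename[OF r])
qed

lemma definable_reindex:
  assumes "definable mem F" "inj f"
  shows "definable mem (\<lambda>e. F (\<lambda>i. e (f i)))"
proof -
  obtain \<phi> p where F: "\<forall>e. F e \<longleftrightarrow> sat mem \<phi> (comb e p)"
    using assms unfolding definable_def by blast
  let ?r = "comb (\<lambda>n. 2 * f n) (\<lambda>n. Suc (2 * n))"
  have r: "inj ?r"
    using \<open>inj f\<close> by (intro inj_comb) (simp_all add: inj_def Suc_double_not_eq_double double_not_eq_Suc_double)
  have "comb e p \<circ> ?r = comb (\<lambda>i. e (f i)) p" for e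
    by (simp only: comp_comb) (simp only: comp_def comb_simps)
  then show ?thesis
    unfolding definable_def using F
    by (intro exI[of _ "rename ?r \<phi>"] exI[of _ p]) (simp only: simp_thms sat_rename[OF r])
qed

lemma definable_imp [definable_intros]:
  assumes "definable mem F" "definable mem G" shows "definable mem (\<lambda>e. F e \<longrightarrow> G e)"
  using definable_not[OF definable_conj[OF assms(1) definable_not[OF assms(2)]]] by simp

lemma definable_disj [definable_intros]:
  assumes "definable mem F" "definable mem G" shows "definable mem (\<lambda>e. F e \<or> G e)"
  using definable_imp[OF definable_not[OF assms(1)] assms(2)] by (simp add: disj_imp)

lemma definable_iff [definable_intros]:
  assumes "definable mem F" "definable mem G" shows "definable mem (\<lambda>e. F e \<longleftrightarrow> G e)"
  using definable_conj[OF definable_imp[OF assms] definable_imp[OF assms(2,1)]]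
  by (simp add: iff_conv_conj_imp)

lemma definable_ex [definable_intros]:
  assumes "definable mem (\<lambda>e. F (e 0) (\<lambda>i. e (Suc i)))"
  shows "definable mem (\<lambda>e. \<exists>a. F a e)"
  using definable_not[OF definable_all[of _ "\<lambda>a e. \<not> F a e"]] definable_not[OF assms] by simp

lemma definable_const [definable_intros]: "definable mem (\<lambda>e. P)"
proof -
  have "definable mem (\<lambda>e. e 0 = e 0)" by (rule definable_eq_var)
  then have "definable mem (\<lambda>e. True)" by simp
  then show ?thesis using definable_not[of mem "\<lambda>e. True"] by (cases P) auto
qed

section \<open>Definable terms and substitution\<close>

lemma definable_term_var [definable_intros]: "definable_term mem (\<lambda>e. e i)"
  unfolding definable_term_def by (rule definable_eq_var)

lemma definable_term_const [definable_intros]: "definable_term mem (\<lambda>e. c)"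
  unfolding definable_term_def by (rule definable_eq_const)

lemma definable_term_shift:
  assumes "definable_term mem t"
  shows "definable_term mem (\<lambda>e. t (\<lambda>i. e (Suc i)))"
  using definable_reindex[of mem _ "case_nat 0 (\<lambda>i. Suc (Suc i))"] assms
  unfolding definable_term_def by (fastforce simp: inj_def split: nat.splits)

text \<open>Quantifying over the value of the term replaces syntactic substitution. Unlike injective
  reindexing, this can also identify two variables.\<close>

lemma definable_subst:
  assumes "definable_term mem t" "definable mem (\<lambda>e. F (e 0) (\<lambda>i. e (Suc i)))"
  shows "definable mem (\<lambda>e. F (t e) e)"
proof -
  have "definable mem (\<lambda>e. \<exists>x. x = t e \<and> F x e)"
    using assms unfolding definable_term_def by (intro definable_ex definable_conj) auto
  then show ?thesis by simp
qed

lemma definable_subst2: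
  assumes "definable mem (\<lambda>e. R (e 0) (e (Suc 0)))"
    and "definable_term mem t" "definable_term mem u"
  shows "definable mem (\<lambda>e. R (t e) (u e))"
proof (rule definable_subst[OF assms(3)], rule definable_subst)
  show "definable_term mem (\<lambda>e. t (\<lambda>i. e (Suc i)))"
    using assms(2) by (rule definable_term_shift)
qed (use assms(1) in simp)

lemma definable_mem [definable_intros]:
  assumes "definable_term mem t" "definable_term mem u"
  shows "definable mem (\<lambda>e. mem (t e) (u e))"
  using definable_subst2[where R = mem, OF definable_mem_var assms] .

lemma definable_eq [definable_intros]:
  assumes "definable_term mem t" "definable_term mem u"
  shows "definable mem (\<lambda>e. t e = u e)"
  using definable_subst2[where R = "(=)", OF definable_eq_var assms] .

lemma definable_in_class [definable_intros]:
  assumes "definable_term mem t" "definable_class mem A"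
  shows "definable mem (\<lambda>e. t e \<in> A e)"
  using definable_subst[OF assms(1), of "\<lambda>x e. x \<in> A e"] assms(2)
  by (simp add: definable_class_def)

subsection \<open>The axioms of ZF\<close>

locale zf =
  fixes mem :: "'m \<Rightarrow> 'm \<Rightarrow> bool"  (infix "\<^bold>\<in>" 50)
  assumes ZF: "ZF_model mem"
begin

abbreviation dfn where "dfn \<equiv> definable mem"
abbreviation dterm where "dterm \<equiv> definable_term mem"
abbreviation dclass where "dclass \<equiv> definable_class mem"

lemmas axioms = ZF[unfolded ZF_model_def]

lemma extensionality: "(\<And>x. x \<^bold>\<in> a \<longleftrightarrow> x \<^bold>\<in> b) \<Longrightarrow> a = b"
  using axioms[THEN conjunct1] by simp

lemma foundation: "x \<^bold>\<in> a \<Longrightarrow> \<exists>x. x \<^bold>\<in> a \<and> \<not> (\<exists>y. y \<^bold>\<in> x \<and> y \<^bold>\<in> a)"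
  using axioms[THEN conjunct2, THEN conjunct1] by (elim allE[of _ a] impE) (rule exI)

lemma pairing: "\<exists>c. \<forall>x. x \<^bold>\<in> c \<longleftrightarrow> x = a \<or> x = b"
  using axioms[THEN conjunct2, THEN conjunct2, THEN conjunct1] by simp

lemma union: "\<exists>u. \<forall>x. x \<^bold>\<in> u \<longleftrightarrow> (\<exists>y. y \<^bold>\<in> a \<and> x \<^bold>\<in> y)"
  using axioms[THEN conjunct2, THEN conjunct2, THEN conjunct2, THEN conjunct1] by (rule spec)

lemma power: "\<exists>p. \<forall>x. x \<^bold>\<in> p \<longleftrightarrow> (\<forall>z. z \<^bold>\<in> x \<longrightarrow> z \<^bold>\<in> a)"
  using axioms[THEN conjunct2, THEN conjunct2, THEN conjunct2, THEN conjunct2, THEN conjunct1]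
  by (rule spec)

lemmas schemata = axioms[THEN conjunct2, THEN conjunct2, THEN conjunct2, THEN conjunct2,
    THEN conjunct2, THEN conjunct2]

lemma separation:
  assumes "dfn (\<lambda>e. P (e 0))"
  shows "\<exists>b. \<forall>x. x \<^bold>\<in> b \<longleftrightarrow> x \<^bold>\<in> a \<and> P x"
proof -
  obtain \<phi> p where P: "\<forall>e. P (e 0) \<longleftrightarrow> sat mem \<phi> (comb e p)"
    using assms unfolding definable_def by blast
  \<comment> \<open>Variable 0 of the schema is place 0 of the environment; the other places are
    filled arbitrarily with \<open>p\<close>, since \<open>P\<close> does not read them.\<close>
  have "P x \<longleftrightarrow> sat mem \<phi> ((comb p p)(0 := x))" for x
  proof -
    have "(comb p p)(0 := x) = comb (p(0 := x)) p"
      by (auto simp: fun_eq_iff comb_def)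
    then show ?thesis using spec[OF P, of "p(0 := x)"] by simp
  qed
  moreover have "\<exists>b. \<forall>x. x \<^bold>\<in> b \<longleftrightarrow> x \<^bold>\<in> a \<and> sat mem \<phi> ((comb p p)(0 := x))"
    using schemata[THEN conjunct1, rule_format] .
  ultimately show ?thesis by simp
qed

text \<open>The reindexing moves the second variable of \<open>R\<close> from place 2 of \<^const>\<open>comb\<close> to place 1.\<close>

lemma replacement:
  assumes R: "dfn (\<lambda>e. R (e 0) (e (Suc 0)))"
    and unique: "\<And>x y y'. x \<^bold>\<in> a \<Longrightarrow> R x y \<Longrightarrow> R x y' \<Longrightarrow> y = y'"
  shows "\<exists>b. \<forall>y. y \<^bold>\<in> b \<longleftrightarrow> (\<exists>x. x \<^bold>\<in> a \<and> R x y)"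
proof -
  \<comment> \<open>The schema asks for exactly one value at every element, so \<open>a\<close> is
    first cut down to the domain of \<open>R\<close>.\<close>
  have "dfn (\<lambda>e. \<exists>y. R (e 0) y)"
    using definable_subst2[OF R definable_term_var definable_term_var, of "Suc 0" 0]
    by (intro definable_ex) simp
  then obtain a' where a': "x \<^bold>\<in> a' \<longleftrightarrow> x \<^bold>\<in> a \<and> (\<exists>y. R x y)" for x
    using separation[of "\<lambda>x. \<exists>y. R x y" a] by blast
  obtain \<phi> p where \<phi>: "\<forall>e. R (e 0) (e (Suc 0)) \<longleftrightarrow> sat mem \<phi> (comb e p)"
    using R unfolding definable_def by blast
  let ?r = "\<lambda>n. if n = 1 then 2 else if n = 2 then 1 else n"
  have r: "inj ?r" by (auto simp: inj_def)
  have sat: "sat mem (rename ?r \<phi>) ((comb p p \<circ> ?r)(0 := x, 1 := y)) \<longleftrightarrow> R x y" for x y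
  proof -
    have "(comb p p \<circ> ?r)(0 := x, 1 := y) \<circ> ?r = comb (p(0 := x, 1 := y)) p"
      by (auto simp: fun_eq_iff comb_def)
    then show ?thesis
      using spec[OF \<phi>, of "p(0 := x, 1 := y)"] by (simp only: sat_rename[OF r]) simp
  qed
  have "(\<forall>x. x \<^bold>\<in> a' \<longrightarrow> (\<exists>!y. sat mem (rename ?r \<phi>) ((comb p p \<circ> ?r)(0 := x, 1 := y)))) \<longrightarrow>
      (\<exists>b. \<forall>y. y \<^bold>\<in> b \<longleftrightarrow>
        (\<exists>x. x \<^bold>\<in> a' \<and> sat mem (rename ?r \<phi>) ((comb p p \<circ> ?r)(0 := x, 1 := y))))"
    using schemata[THEN conjunct2, THEN spec, THEN spec, THEN spec] .
  then show ?thesis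
    unfolding sat using a' unique by (metis (no_types, opaque_lifting))
qed

section \<open>Set terms of the model and their definability\<close>

definition is_set :: "('m \<Rightarrow> bool) \<Rightarrow> bool" where
  "is_set P \<longleftrightarrow> (\<exists>a. \<forall>x. x \<^bold>\<in> a \<longleftrightarrow> P x)"

lemma the_set:
  assumes "is_set P" shows "x \<^bold>\<in> the_set mem P \<longleftrightarrow> P x"
proof -
  have "\<exists>!a. \<forall>x. x \<^bold>\<in> a \<longleftrightarrow> P x"
    using assms extensionality unfolding is_set_def by metis
  from theI'[OF this] show ?thesis unfolding the_set_def by blast
qed

lemma the_set_eq:
  assumes "\<And>x. x \<^bold>\<in> a \<longleftrightarrow> P x" shows "the_set mem P = a"
  using assms the_set[of P] extensionality unfolding is_set_def by metis

lemma is_set_subset: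
  assumes "\<And>x. P x \<Longrightarrow> x \<^bold>\<in> a" "dfn (\<lambda>e. P (e 0))"
  shows "is_set P"
  using separation[OF assms(2), of a] assms(1) unfolding is_set_def by blast

lemma mem_zero [simp]: "\<not> x \<^bold>\<in> zero mem"
proof -
  have "is_set (\<lambda>x. False)"
    using separation[of "\<lambda>x. False"] definable_const unfolding is_set_def by blast
  then show ?thesis unfolding zero_def by (simp add: the_set)
qed

lemma mem_upair [simp]: "x \<^bold>\<in> upair mem a b \<longleftrightarrow> x = a \<or> x = b"
  using pairing unfolding upair_def by (intro the_set) (simp add: is_set_def)

lemma binary_union: "\<exists>c. \<forall>x. x \<^bold>\<in> c \<longleftrightarrow> x \<^bold>\<in> a \<or> x \<^bold>\<in> b"
proof -
  obtain c where "\<forall>x. x \<^bold>\<in> c \<longleftrightarrow> (\<exists>y. y \<^bold>\<in> upair mem a b \<and> x \<^bold>\<in> y)"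
    using union by blast
  then show ?thesis by (intro exI[of _ c]) auto
qed

lemma mem_succ [simp]: "x \<^bold>\<in> succ mem a \<longleftrightarrow> x \<^bold>\<in> a \<or> x = a"
  using binary_union[of a "upair mem a a"] unfolding succ_def
  by (intro the_set) (simp add: is_set_def)

lemma upair_eq_iff: "upair mem a b = upair mem c d \<longleftrightarrow> (a = c \<and> b = d \<or> a = d \<and> b = c)"
proof
  assume eq: "upair mem a b = upair mem c d"
  have "x = a \<or> x = b \<longleftrightarrow> x = c \<or> x = d" for x
    using mem_upair[of x a b] mem_upair[of x c d] eq by simp
  then show "a = c \<and> b = d \<or> a = d \<and> b = c" by metis
next
  assume "a = c \<and> b = d \<or> a = d \<and> b = c"
  then show "upair mem a b = upair mem c d" by (intro extensionality) auto
qed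

lemma pair_eq_iff [simp]: "pair mem a b = pair mem c d \<longleftrightarrow> a = c \<and> b = d"
  unfolding pair_def by (auto simp: upair_eq_iff)

text \<open>\<open>the_set\<close> is total: when the extension is not a set, its value is the fixed
  individual \<open>THE a. False\<close>, which can be a parameter. So set terms are definable
  without a proof that their extensions are sets.\<close>

lemma definable_term_the_set [definable_intros]:
  assumes "dfn (\<lambda>e. P (e 0) (\<lambda>i. e (Suc i)))"
  shows "dterm (\<lambda>e. the_set mem (\<lambda>x. P x e))"
proof -
  \<comment> \<open>Under the quantifiers the element keeps place 0, and the arguments move past
    \<open>y\<close>, or past both \<open>a\<close> and \<open>y\<close>.\<close>
  have inj: "inj (case_nat 0 (\<lambda>i. Suc (Suc i)))" "inj (case_nat 0 (\<lambda>i. Suc (Suc (Suc i))))"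
    by (auto simp: inj_def split: nat.split)
  note 1 = definable_reindex[OF assms inj(1), unfolded nat.case]
  note 2 = definable_reindex[OF assms inj(2), unfolded nat.case]
  have "y = the_set mem Q \<longleftrightarrow> (\<forall>x. x \<^bold>\<in> y \<longleftrightarrow> Q x) \<or>
      \<not> (\<exists>a. \<forall>x. x \<^bold>\<in> a \<longleftrightarrow> Q x) \<and> y = (THE a. False)" for y Q
  proof (cases "is_set Q")
    case True
    then show ?thesis
      using the_set[OF True] the_set_eq[of y Q] True unfolding is_set_def by auto
  next
    case False
    then have "(\<lambda>a. \<forall>x. x \<^bold>\<in> a \<longleftrightarrow> Q x) = (\<lambda>a. False)"
      by (intro ext) (simp add: is_set_def)
    from arg_cong[OF this, of The] have "the_set mem Q = (THE a. False)"
      unfolding the_set_def .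
    with False show ?thesis
      by (auto simp: is_set_def)
  qed
  note char = this
  show ?thesis
    unfolding definable_term_def char by (intro definable_intros 1 2)
qed

lemma definable_term_comp:
  assumes "dterm (\<lambda>e. f (e 0))" "dterm t"
  shows "dterm (\<lambda>e. f (t e))"
  using definable_subst2[where R = "\<lambda>a b. a = f b", OF _ definable_term_var definable_term_shift]
    assms unfolding definable_term_def by simp

lemma definable_term_comp2:
  assumes "dterm (\<lambda>e. f (e 0) (e (Suc 0)))" "dterm t" "dterm u"
  shows "dterm (\<lambda>e. f (t e) (u e))"
proof -
  \<comment> \<open>Swapping places 0 and 2 brings the second argument to place 0, where
    \<open>definable_subst\<close> acts; the value waits in place 2.\<close>
  let ?p = "\<lambda>n::nat. if n = 0 then 2 else if n = 1 then 1 else if n = 2 then 0 else n"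
  have "inj ?p" by (auto simp: inj_def)
  from definable_reindex[OF assms(1)[unfolded definable_term_def] this]
  have *: "dfn (\<lambda>e. e (Suc (Suc 0)) = f (e (Suc 0)) (e 0))"
    by (simp add: numeral_2_eq_2)
  have "dfn (\<lambda>e. e (Suc 0) = f (e 0) (u (\<lambda>i. e (Suc (Suc i)))))"
    using definable_subst[where F = "\<lambda>y e. e (Suc 0) = f (e 0) y",
        OF definable_term_shift[OF definable_term_shift[OF assms(3)]]] * by simp
  then show ?thesis
    unfolding definable_term_def
    using definable_subst[where F = "\<lambda>x e. e 0 = f x (u (\<lambda>i. e (Suc i)))",
        OF definable_term_shift[OF assms(2)]] by simp
qed

lemma definable_term_upair [definable_intros]:
  assumes "dterm t" "dterm u" shows "dterm (\<lambda>e. upair mem (t e) (u e))"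
  by (rule definable_term_comp2[OF _ assms], unfold upair_def) (intro definable_intros)

lemma definable_term_pair [definable_intros]:
  assumes "dterm t" "dterm u" shows "dterm (\<lambda>e. pair mem (t e) (u e))"
  unfolding pair_def by (intro definable_intros assms)

lemma definable_term_Cl [definable_intros]:
  assumes "dterm t" shows "dterm (\<lambda>e. Cl mem (t e))"
  by (rule definable_term_comp[OF _ assms], unfold Cl_def transitive_def subset_def)
    (intro definable_intros)

text \<open>Kuratowski pairs with components in the union of \<open>a\<close> and \<open>b\<close>
  lie in its double power set, so separation gives the product.\<close>

lemma mem_cartesian [simp]:
  "p \<^bold>\<in> cartesian mem a b \<longleftrightarrow> (\<exists>x y. x \<^bold>\<in> a \<and> y \<^bold>\<in> b \<and> p = pair mem x y)"
proof -
  obtain c where c: "\<forall>x. x \<^bold>\<in> c \<longleftrightarrow> x \<^bold>\<in> a \<or> x \<^bold>\<in> b"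
    using binary_union by blast
  obtain c' where c': "\<forall>x. x \<^bold>\<in> c' \<longleftrightarrow> (\<forall>z. z \<^bold>\<in> x \<longrightarrow> z \<^bold>\<in> c)"
    using power by blast
  obtain c'' where c'': "\<forall>x. x \<^bold>\<in> c'' \<longleftrightarrow> (\<forall>z. z \<^bold>\<in> x \<longrightarrow> z \<^bold>\<in> c')"
    using power by blast
  have "is_set (\<lambda>p. \<exists>x y. x \<^bold>\<in> a \<and> y \<^bold>\<in> b \<and> p = pair mem x y)"
  proof (rule is_set_subset)
    show "p \<^bold>\<in> c''" if "\<exists>x y. x \<^bold>\<in> a \<and> y \<^bold>\<in> b \<and> p = pair mem x y" for p
      using that c c' c'' by (auto simp: pair_def)
  qed (intro definable_intros)
  then show ?thesis unfolding cartesian_def by (simp only: the_set)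
qed

lemma zero_ne_one [simp]: "zero mem \<noteq> one mem"
  using mem_succ[of "zero mem" "zero mem"] unfolding one_def by (metis mem_zero)

lemma definable_comp:
  assumes "dfn (\<lambda>e. Q (e 0))" "dterm t"
  shows "dfn (\<lambda>e. Q (t e))"
  using definable_subst[where F = "\<lambda>x e. Q x", OF assms(2,1)] .

lemma definable_class_shift:
  assumes "dclass A"
  shows "dclass (\<lambda>e. A (\<lambda>i. e (Suc i)))"
proof -
  have inj: "inj (case_nat 0 (\<lambda>i. Suc (Suc i)))"
    by (auto simp: inj_def split: nat.split)
  show ?thesis
    using definable_reindex[OF assms[unfolded definable_class_def] inj, unfolded nat.case]
    unfolding definable_class_def .
qed

lemma definable_class_comp:
  assumes "dfn (\<lambda>e. e 0 \<in> V (e (Suc 0)))" "dterm t"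
  shows "dclass (\<lambda>e. V (t e))"
  unfolding definable_class_def
  using definable_subst2[where R = "\<lambda>a b. a \<in> V b",
      OF assms(1) definable_term_var definable_term_shift[OF assms(2)]] .

lemma definable_transitive [definable_intros]:
  assumes "dterm t" shows "dfn (\<lambda>e. transitive mem (t e))"
  by (rule definable_comp[OF _ assms], unfold transitive_def subset_def) (intro definable_intros)

lemma definable_is_ordinal [definable_intros]:
  assumes "dterm t" shows "dfn (\<lambda>e. is_ordinal mem (t e))"
  by (rule definable_comp[OF _ assms], unfold is_ordinal_def) (intro definable_intros)

subsection \<open>Ordinals\<close>

lemma mem_irrefl: "\<not> x \<^bold>\<in> x"
  using foundation[of x "upair mem x x"] by auto

abbreviation ord where "ord \<equiv> is_ordinal mem"

lemma ord_trans: "ord a \<Longrightarrow> x \<^bold>\<in> a \<Longrightarrow> y \<^bold>\<in> x \<Longrightarrow> y \<^bold>\<in> a"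
  unfolding is_ordinal_def transitive_def subset_def by blast

lemma ord_mem: "ord a \<Longrightarrow> x \<^bold>\<in> a \<Longrightarrow> ord x"
  unfolding is_ordinal_def transitive_def subset_def by blast

text \<open>Foundation speaks of sets only, so the class \<open>P\<close> is cut down to
  \<open>succ mem a\<close>. Transitivity makes a minimal element there minimal for the whole
  class.\<close>

lemma ord_minimal:
  assumes "ord a" "P a" "dfn (\<lambda>e. P (e 0))"
  shows "\<exists>m. ord m \<and> P m \<and> (\<forall>y. y \<^bold>\<in> m \<longrightarrow> \<not> P y)"
proof -
  obtain b where b: "\<forall>x. x \<^bold>\<in> b \<longleftrightarrow> x \<^bold>\<in> succ mem a \<and> P x"
    using separation[OF assms(3)] by blast
  then have "a \<^bold>\<in> b" using assms by simp
  from foundation[OF this] obtain m where m: "m \<^bold>\<in> b" "\<not> (\<exists>y. y \<^bold>\<in> m \<and> y \<^bold>\<in> b)"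
    by blast
  have "\<not> P y" if "y \<^bold>\<in> m" for y
    using m b that ord_trans[OF assms(1)] by auto
  moreover have "ord m" "P m"
    using m(1) b assms(1) ord_mem by auto
  ultimately show ?thesis by blast
qed

text \<open>Two nested minimal counterexamples: \<open>a0\<close> incomparable with some ordinal,
  then \<open>b0\<close> incomparable with \<open>a0\<close>. Minimality forces them to have the
  same elements.\<close>

lemma ord_linear:
  assumes "ord a" "ord b"
  shows "a \<^bold>\<in> b \<or> a = b \<or> b \<^bold>\<in> a"
proof (rule ccontr)
  let ?C = "\<lambda>a b. a \<^bold>\<in> b \<or> a = b \<or> b \<^bold>\<in> a"
  assume "\<not> ?C a b"
  then have "\<exists>b. ord b \<and> \<not> ?C a b" using assms by blast
  moreover have "dfn (\<lambda>e. \<exists>b. ord b \<and> \<not> ?C (e 0) b)" by (intro definable_intros)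
  ultimately obtain a0 where a0: "ord a0" "\<exists>b. ord b \<and> \<not> ?C a0 b"
    and min_a: "\<forall>y. y \<^bold>\<in> a0 \<longrightarrow> \<not> (\<exists>b. ord b \<and> \<not> ?C y b)"
    using ord_minimal[OF assms(1), of "\<lambda>a. \<exists>b. ord b \<and> \<not> ?C a b"] by blast
  then obtain b where b: "ord b" "\<not> ?C a0 b" by blast
  moreover have "dfn (\<lambda>e. \<not> ?C a0 (e 0))" by (intro definable_intros)
  ultimately obtain b0 where b0: "ord b0" "\<not> ?C a0 b0"
    and min_b: "\<forall>y. y \<^bold>\<in> b0 \<longrightarrow> \<not> \<not> ?C a0 y"
    using ord_minimal[of b "\<lambda>b. \<not> ?C a0 b"] by blast
  have "x \<^bold>\<in> a0" if "x \<^bold>\<in> b0" for x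
    using min_b that b0 ord_trans by blast
  moreover have "x \<^bold>\<in> b0" if "x \<^bold>\<in> a0" for x
    using min_a that a0(1) b0 ord_trans by blast
  ultimately have "a0 = b0" by (intro extensionality) blast
  then show False using b0 by blast
qed

lemma burali_forti: "\<exists>a. ord a \<and> \<not> a \<^bold>\<in> b"
proof (rule ccontr)
  assume *: "\<not> ?thesis"
  have "dfn (\<lambda>e. ord (e 0))" by (intro definable_intros)
  from separation[OF this, of b] * obtain c where c: "\<forall>x. x \<^bold>\<in> c \<longleftrightarrow> ord x" by blast
  have "ord c"
    unfolding is_ordinal_def transitive_def subset_def
    using c ord_mem ord_trans by blast
  then show False using c mem_irrefl by blast
qed

text \<open>Ordinals are their own closure, so on them the relation in \<open>D\<close> at
  \<open>one\<close> is membership.\<close>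

lemma Cl_transitive:
  assumes "transitive mem a" shows "Cl mem a = a"
  unfolding Cl_def
  by (rule the_set_eq) (use assms in \<open>auto simp: subset_def\<close>)

end

section \<open>Realizability\<close>

locale realizability_model = zf mem
  for mem :: "'m \<Rightarrow> 'm \<Rightarrow> bool"  (infix "\<^bold>\<in>" 50) +
  fixes \<A> :: "'m ralg"
  assumes algebra: "realizability_algebra mem \<A>"
begin

abbreviation app' :: "'m \<Rightarrow> 'm \<Rightarrow> 'm"  (infixl "\<^bold>\<cdot>" 75) where "app' \<equiv> app mem \<A>"
abbreviation push' :: "'m \<Rightarrow> 'm \<Rightarrow> 'm"  (infixr "\<^bold>#" 70) where "push' \<equiv> push mem \<A>"
abbreviation cut' :: "'m \<Rightarrow> 'm \<Rightarrow> 'm"  (infix "\<^bold>\<star>" 65) where "cut' \<equiv> cut mem \<A>"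
abbreviation trm where "trm \<xi> \<equiv> \<xi> \<^bold>\<in> Lam \<A>"
abbreviation stack where "stack \<pi> \<equiv> \<pi> \<^bold>\<in> Stk \<A>"
abbreviation pole where "pole p \<equiv> p \<^bold>\<in> Pole \<A>"
abbreviation \<B> where "\<B> \<equiv> cB \<A>"
abbreviation \<C> where "\<C> \<equiv> cC \<A>"
abbreviation \<I> where "\<I> \<equiv> cI \<A>"

lemma fapply_iff:
  assumes "is_fun mem f a b" "x \<^bold>\<in> a"
  shows "pair mem x y \<^bold>\<in> f \<longleftrightarrow> y = fapply mem f x"
proof -
  have "\<exists>!y. pair mem x y \<^bold>\<in> f" using assms unfolding is_fun_def by blast
  from theI'[OF this] this show ?thesis unfolding fapply_def by blast
qed

lemma fapply_mem:
  assumes "is_fun mem f a b" "x \<^bold>\<in> a"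
  shows "fapply mem f x \<^bold>\<in> b"
proof -
  have "pair mem x (fapply mem f x) \<^bold>\<in> f" using fapply_iff[OF assms] by simp
  then have "pair mem x (fapply mem f x) \<^bold>\<in> cartesian mem a b"
    using assms(1) unfolding is_fun_def subset_def by blast
  then show ?thesis by simp
qed

lemmas algebra_unfolded = algebra[unfolded realizability_algebra_def]
lemmas App = algebra_unfolded[THEN conjunct1]
lemmas Push = algebra_unfolded[THEN conjunct2, THEN conjunct1]
lemmas Cut = algebra_unfolded[THEN conjunct2, THEN conjunct2, THEN conjunct1]
lemmas algebra_rest = algebra_unfolded[THEN conjunct2, THEN conjunct2, THEN conjunct2,
    THEN conjunct2, THEN conjunct2]

lemma app_term [simp, intro]: "trm \<xi> \<Longrightarrow> trm \<eta> \<Longrightarrow> trm (\<xi> \<^bold>\<cdot> \<eta>)"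
  unfolding app_def by (rule fapply_mem[OF App]) simp

lemma push_stack [simp, intro]: "trm \<xi> \<Longrightarrow> stack \<pi> \<Longrightarrow> stack (\<xi> \<^bold># \<pi>)"
  unfolding push_def by (rule fapply_mem[OF Push]) simp

lemma push_iff:
  "trm \<xi> \<Longrightarrow> stack \<pi> \<Longrightarrow> pair mem (pair mem \<xi> \<pi>) \<rho> \<^bold>\<in> Push \<A> \<longleftrightarrow> \<rho> = \<xi> \<^bold># \<pi>"
  unfolding push_def by (rule fapply_iff[OF Push]) simp

lemma cut_iff:
  "trm \<xi> \<Longrightarrow> stack \<pi> \<Longrightarrow> pair mem (pair mem \<xi> \<pi>) q \<^bold>\<in> Cut \<A> \<longleftrightarrow> q = \<xi> \<^bold>\<star> \<pi>"
  unfolding cut_def by (rule fapply_iff[OF Cut]) simp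

lemma pole_exec: "exec mem \<A> p q \<Longrightarrow> pole q \<Longrightarrow> pole p"
  using algebra_rest by blast

lemma proof_like_term: "\<xi> \<^bold>\<in> QP \<A> \<Longrightarrow> trm \<xi>"
  using algebra_rest unfolding subset_def by blast

lemma proof_like [simp, intro]: "\<B> \<^bold>\<in> QP \<A>" "\<C> \<^bold>\<in> QP \<A>" "\<I> \<^bold>\<in> QP \<A>"
  using algebra_rest by blast+

lemma proof_like_app [simp, intro]: "\<xi> \<^bold>\<in> QP \<A> \<Longrightarrow> \<eta> \<^bold>\<in> QP \<A> \<Longrightarrow> \<xi> \<^bold>\<cdot> \<eta> \<^bold>\<in> QP \<A>"
  using algebra_rest by blast

lemma combinator_term [simp, intro]: "trm \<B>" "trm \<C>" "trm \<I>"
  by (simp_all add: proof_like_term)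

lemma pole_app: "pole (\<xi> \<^bold>\<star> \<eta> \<^bold># \<pi>) \<Longrightarrow> trm \<xi> \<Longrightarrow> trm \<eta> \<Longrightarrow> stack \<pi> \<Longrightarrow> pole (\<xi> \<^bold>\<cdot> \<eta> \<^bold>\<star> \<pi>)"
  by (rule pole_exec[OF exec_app])

lemma pole_I: "pole (\<xi> \<^bold>\<star> \<pi>) \<Longrightarrow> trm \<xi> \<Longrightarrow> stack \<pi> \<Longrightarrow> pole (\<I> \<^bold>\<star> \<xi> \<^bold># \<pi>)"
  by (rule pole_exec[OF exec_I])

lemma pole_B:
  "pole (\<xi> \<^bold>\<star> \<eta> \<^bold>\<cdot> \<zeta> \<^bold># \<pi>) \<Longrightarrow> trm \<xi> \<Longrightarrow> trm \<eta> \<Longrightarrow> trm \<zeta> \<Longrightarrow> stack \<pi> \<Longrightarrow>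
    pole (\<B> \<^bold>\<star> \<xi> \<^bold># \<eta> \<^bold># \<zeta> \<^bold># \<pi>)"
  by (rule pole_exec[OF exec_B], assumption+, rule pole_app) auto

lemma pole_C:
  "pole (\<xi> \<^bold>\<star> \<zeta> \<^bold># \<eta> \<^bold># \<pi>) \<Longrightarrow> trm \<xi> \<Longrightarrow> trm \<eta> \<Longrightarrow> trm \<zeta> \<Longrightarrow> stack \<pi> \<Longrightarrow>
    pole (\<C> \<^bold>\<star> \<xi> \<^bold># \<eta> \<^bold># \<zeta> \<^bold># \<pi>)"
  by (rule pole_exec[OF exec_C])

section \<open>Truth values as sets of stacks, and their definability\<close>

subsection \<open>Truth values\<close>

text \<open>The truth value of \<open>NotEps x X\<close>. An individual \<open>X\<close> thus codes
  a family of truth values, and such families are what \<open>D\<close> quantifies over.\<close>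

definition fiber :: "'m \<Rightarrow> 'm \<Rightarrow> 'm set" where
  "fiber X x = {\<pi>. stack \<pi> \<and> pair mem x \<pi> \<^bold>\<in> X}"

text \<open>Realizability for a truth value given directly as a set instead of by a formula.
  Elements of \<open>A\<close> that are not stacks are ignored.\<close>

definition rz :: "'m \<Rightarrow> 'm set \<Rightarrow> bool" where
  "rz v A \<longleftrightarrow> trm v \<and> (\<forall>\<rho>\<in>A. stack \<rho> \<longrightarrow> pole (v \<^bold>\<star> \<rho>))"

definition imp :: "'m set \<Rightarrow> 'm set \<Rightarrow> 'm set" where
  "imp A B = {v \<^bold># \<pi> | v \<pi>. rz v A \<and> stack \<pi> \<and> \<pi> \<in> B}"

definition \<Phi> :: "'m set \<Rightarrow> 'm set \<Rightarrow> 'm set" where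
  "\<Phi> U A = imp (imp A U) U"

lemma stack_fiber: "\<pi> \<in> fiber X x \<Longrightarrow> stack \<pi>"
  by (simp add: fiber_def)

lemma rz_trm: "rz v A \<Longrightarrow> trm v"
  by (simp add: rz_def)

lemma rzD: "rz v A \<Longrightarrow> \<rho> \<in> A \<Longrightarrow> stack \<rho> \<Longrightarrow> pole (v \<^bold>\<star> \<rho>)"
  by (simp add: rz_def)

lemma rz_mono: "rz v B \<Longrightarrow> A \<subseteq> B \<Longrightarrow> rz v A"
  by (auto simp: rz_def)

lemma impI': "rz v A \<Longrightarrow> \<pi> \<in> B \<Longrightarrow> stack \<pi> \<Longrightarrow> v \<^bold># \<pi> \<in> imp A B"
  by (auto simp: imp_def)

lemma stack_imp: "\<pi> \<in> imp A B \<Longrightarrow> stack \<pi>"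
  by (auto simp: imp_def rz_trm)

lemma imp_antimono: "A \<subseteq> A' \<Longrightarrow> imp A' B \<subseteq> imp A B"
  unfolding imp_def using rz_mono by blast

lemma \<Phi>_mono: "A \<subseteq> B \<Longrightarrow> \<Phi> U A \<subseteq> \<Phi> U B"
  unfolding \<Phi>_def by (intro imp_antimono)

lemma stack_\<Phi>: "\<pi> \<in> \<Phi> U A \<Longrightarrow> stack \<pi>"
  unfolding \<Phi>_def by (rule stack_imp)

lemma definable_class_fiber [definable_intros]:
  assumes "dterm t" "dterm u" shows "dclass (\<lambda>e. fiber (t e) (u e))"
  unfolding definable_class_def fiber_def mem_Collect_eq
  by (intro definable_intros assms[THEN definable_term_shift])

text \<open>Push and cut enter through their graphs, which are individuals; the right side is
  therefore first-order with parameters, as the definability rules require.\<close>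

lemma mem_imp_iff:
  "\<pi> \<in> imp A B \<longleftrightarrow> (\<exists>v \<rho>. trm v \<and> stack \<rho> \<and> \<rho> \<in> B \<and> pair mem (pair mem v \<rho>) \<pi> \<^bold>\<in> Push \<A> \<and>
    (\<forall>\<sigma>. \<sigma> \<in> A \<and> stack \<sigma> \<longrightarrow> (\<exists>q. pole q \<and> pair mem (pair mem v \<sigma>) q \<^bold>\<in> Cut \<A>)))"
proof -
  have "rz v A \<longleftrightarrow> trm v \<and> (\<forall>\<sigma>. \<sigma> \<in> A \<and> stack \<sigma> \<longrightarrow>
      (\<exists>q. pole q \<and> pair mem (pair mem v \<sigma>) q \<^bold>\<in> Cut \<A>))" for v
    unfolding rz_def by (auto simp: cut_iff)
  moreover have "\<pi> \<in> imp A B \<longleftrightarrow> (\<exists>v \<rho>. \<pi> = v \<^bold># \<rho> \<and> rz v A \<and> stack \<rho> \<and> \<rho> \<in> B)"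
    unfolding imp_def by blast
  ultimately show ?thesis
    using push_iff by (intro iffI) metis+
qed

lemma definable_class_imp [definable_intros]:
  assumes "dclass A" "dclass B" shows "dclass (\<lambda>e. imp (A e) (B e))"
  unfolding definable_class_def mem_imp_iff
  by (intro definable_intros assms definable_class_shift)

lemma definable_class_\<Phi> [definable_intros]:
  assumes "dclass A" "dclass B" shows "dclass (\<lambda>e. \<Phi> (A e) (B e))"
  unfolding \<Phi>_def by (intro definable_intros assms)

text \<open>A definable family over all individuals need not be an individual. Its restriction to an
  index set \<open>E\<close> is separated from the product of \<open>E\<close> with the stacks, and
  \<open>D\<close> can be instantiated at it.\<close>

lemma ex_fiber:
  assumes "dfn (\<lambda>e. e 0 \<in> F (e (Suc 0)))"
  shows "\<exists>X. \<forall>y. fiber X y = (if y \<^bold>\<in> E then {\<pi>\<in>F y. stack \<pi>} else {})"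
proof -
  have "dfn (\<lambda>e. \<exists>y \<pi>. y \<^bold>\<in> E \<and> \<pi> \<in> F y \<and> e 0 = pair mem y \<pi>)"
    by (intro definable_intros definable_class_comp[OF assms])
  from separation[OF this, of "cartesian mem E (Stk \<A>)"]
  obtain X where "\<forall>z. z \<^bold>\<in> X \<longleftrightarrow> z \<^bold>\<in> cartesian mem E (Stk \<A>) \<and>
      (\<exists>y \<pi>. y \<^bold>\<in> E \<and> \<pi> \<in> F y \<and> z = pair mem y \<pi>)" by blast
  then show ?thesis
    unfolding fiber_def by (intro exI[of _ X]) (simp add: set_eq_iff, blast)
qed

end

section \<open>Recursive families of truth values as greatest fixed points\<close>

subsection \<open>Fixed points\<close>

text \<open>Two recursions are instances: along membership with constant \<open>V\<close>, and along
  the closure relation on an index set with \<open>V\<close> the fibers of \<open>X\<close>. A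
  greatest fixed point gives a definable solution without transfinite recursion in the
  model.\<close>

locale truth_family = realizability_model mem \<A>
  for mem :: "'m \<Rightarrow> 'm \<Rightarrow> bool"  (infix "\<^bold>\<in>" 50) and \<A> :: "'m ralg" +
  fixes r :: "'m \<Rightarrow> 'm \<Rightarrow> bool" and V :: "'m \<Rightarrow> 'm set"
  assumes definable_r: "dfn (\<lambda>e. r (e 0) (e (Suc 0)))"
    and definable_V: "dfn (\<lambda>e. e 0 \<in> V (e (Suc 0)))"
begin

text \<open>
  The greatest fixed point is a class of the model: the union of the postfixed families that are
  individuals.
\<close>

definition postfixed :: "'m \<Rightarrow> bool" where
  "postfixed R \<longleftrightarrow> (\<forall>z. z \<^bold>\<in> R \<longrightarrow>
     (\<exists>y \<pi> y'. z = pair mem y \<pi> \<and> r y' y \<and> \<pi> \<in> \<Phi> (V y') (fiber R y')))"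

definition P :: "'m \<Rightarrow> 'm set" where
  "P y = {\<pi>. \<exists>R. postfixed R \<and> \<pi> \<in> fiber R y}"

lemma definable_P: "dfn (\<lambda>e. e 0 \<in> P (e (Suc 0)))"
  unfolding P_def mem_Collect_eq postfixed_def
  by (intro definable_intros definable_class_comp[OF definable_V]
      definable_subst2[where R = r, OF definable_r])

lemma fiber_subset_P: "postfixed R \<Longrightarrow> fiber R y \<subseteq> P y"
  unfolding P_def by blast

lemma stack_P: "\<pi> \<in> P y \<Longrightarrow> stack \<pi>"
  unfolding P_def using stack_fiber by blast

text \<open>A union of postfixed families is postfixed because \<open>\<Phi> U\<close> is
  monotone.\<close>

lemma P_unfold:
  assumes "\<pi> \<in> P y"
  shows "\<exists>y'. r y' y \<and> \<pi> \<in> \<Phi> (V y') (P y')"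
proof -
  obtain R where R: "postfixed R" "\<pi> \<in> fiber R y"
    using assms unfolding P_def by blast
  then have "pair mem y \<pi> \<^bold>\<in> R" by (simp add: fiber_def)
  from R(1)[unfolded postfixed_def, THEN spec, THEN mp, OF this]
  obtain y' where "r y' y" "\<pi> \<in> \<Phi> (V y') (fiber R y')" by auto
  then show ?thesis
    using \<Phi>_mono[OF fiber_subset_P[OF R(1)]] by blast
qed

text \<open>The usual argument adds a point to the greatest fixed point, but \<open>P\<close> need
  not be an individual. Its restriction to a set \<open>E\<close> closed under predecessors,
  together with the pair of \<open>y\<close> and \<open>\<sigma>\<close>, is an individual and still
  postfixed.\<close>

lemma P_fold:
  assumes closed: "\<And>z z'. z \<^bold>\<in> E \<or> z = y \<Longrightarrow> r z' z \<Longrightarrow> z' \<^bold>\<in> E"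
    and "r y' y" "\<sigma> \<in> \<Phi> (V y') (P y')"
  shows "\<sigma> \<in> P y"
proof -
  have "dfn (\<lambda>e. \<exists>z \<tau>. e 0 = pair mem z \<tau> \<and> (z \<^bold>\<in> E \<and> \<tau> \<in> P z \<or> z = y \<and> \<tau> = \<sigma>))"
    by (intro definable_intros definable_class_comp[OF definable_P])
  note dfn_R = this
  obtain E' where E': "\<forall>x. x \<^bold>\<in> E' \<longleftrightarrow> x \<^bold>\<in> E \<or> x = y"
    using binary_union[of E "upair mem y y"] by auto
  from separation[OF dfn_R, of "cartesian mem E' (Stk \<A>)"]
  obtain R where "\<forall>w. w \<^bold>\<in> R \<longleftrightarrow> w \<^bold>\<in> cartesian mem E' (Stk \<A>) \<and>
      (\<exists>z \<tau>. w = pair mem z \<tau> \<and> (z \<^bold>\<in> E \<and> \<tau> \<in> P z \<or> z = y \<and> \<tau> = \<sigma>))" by blast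
  moreover have \<sigma>: "stack \<sigma>" using assms(3) stack_\<Phi> by blast
  ultimately have R: "w \<^bold>\<in> R \<longleftrightarrow>
      (\<exists>z \<tau>. w = pair mem z \<tau> \<and> (z \<^bold>\<in> E \<and> \<tau> \<in> P z \<or> z = y \<and> \<tau> = \<sigma>))" for w
    unfolding mem_cartesian using E' stack_P by blast
  have P_R: "P z \<subseteq> fiber R z" if "z \<^bold>\<in> E" for z
    using that R stack_P by (auto simp: fiber_def)
  have step: "\<exists>z'. r z' z \<and> \<tau> \<in> \<Phi> (V z') (fiber R z')"
    if "z \<^bold>\<in> E \<and> \<tau> \<in> P z \<or> z = y \<and> \<tau> = \<sigma>" for z \<tau>
  proof -
    have "\<exists>z'. r z' z \<and> \<tau> \<in> \<Phi> (V z') (P z')"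
      using that assms(2,3) P_unfold[of \<tau> z] by (elim disjE) auto
    then obtain z' where z': "r z' z" "\<tau> \<in> \<Phi> (V z') (P z')"
      by (elim exE conjE)
    have "z' \<^bold>\<in> E"
      by (rule closed[OF _ z'(1)]) (use that in auto)
    from \<Phi>_mono[OF P_R[OF this]] z' show ?thesis by (intro exI[of _ z']) auto
  qed
  have "postfixed R"
    unfolding postfixed_def
  proof (intro allI impI)
    fix w assume "w \<^bold>\<in> R"
    then obtain z \<tau> where w: "w = pair mem z \<tau>" "z \<^bold>\<in> E \<and> \<tau> \<in> P z \<or> z = y \<and> \<tau> = \<sigma>"
      using R by blast
    from step[OF w(2)] w(1)
    show "\<exists>z \<tau> z'. w = pair mem z \<tau> \<and> r z' z \<and> \<tau> \<in> \<Phi> (V z') (fiber R z')"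
      by blast
  qed
  moreover have "\<sigma> \<in> fiber R y"
    using R \<sigma> by (auto simp: fiber_def)
  ultimately show ?thesis unfolding P_def by blast
qed

lemma P_eq:
  assumes "\<And>z z'. z \<^bold>\<in> E \<or> z = y \<Longrightarrow> r z' z \<Longrightarrow> z' \<^bold>\<in> E"
  shows "\<pi> \<in> P y \<longleftrightarrow> (\<exists>y'. r y' y \<and> \<pi> \<in> \<Phi> (V y') (P y'))"
proof
  assume "\<pi> \<in> P y"
  then show "\<exists>y'. r y' y \<and> \<pi> \<in> \<Phi> (V y') (P y')" by (rule P_unfold)
next
  assume "\<exists>y'. r y' y \<and> \<pi> \<in> \<Phi> (V y') (P y')"
  then show "\<pi> \<in> P y" using P_fold[of E y, OF assms] by (elim exE conjE)
qed

end

section \<open>Well-foundedness\<close>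

context realizability_model
begin

section \<open>Realizers of \<open>D\<close>, and the stationary sequence\<close>

definition less :: "'m \<Rightarrow> 'm \<Rightarrow> 'm \<Rightarrow> bool" where
  "less \<alpha> y x \<longleftrightarrow> bge mem (char_less mem y x) \<alpha>"

lemma less_zero: "less (zero mem) y x"
  by (simp add: less_def bge_def band_def)

lemma less_one: "less (one mem) y x \<longleftrightarrow> y \<^bold>\<in> Cl mem x"
  using zero_ne_one by (simp add: less_def bge_def band_def char_less_def)

text \<open>Says that \<open>\<eta>\<close> realizes the premise of \<open>D\<close> at the instance
  \<open>X\<close>; the set under \<open>rz\<close> is the truth value of the induction hypothesis
  at \<open>x\<close>.\<close>

definition progressive :: "'m \<Rightarrow> 'm \<Rightarrow> 'm \<Rightarrow> bool" where
  "progressive \<alpha> X \<eta> \<longleftrightarrow> trm \<eta> \<and> (\<forall>x v \<pi>. rz v {\<rho>. \<exists>y. less \<alpha> y x \<and> \<rho> \<in> fiber X y} \<longrightarrow>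
     \<pi> \<in> fiber X x \<longrightarrow> pole (\<eta> \<^bold>\<star> v \<^bold># \<pi>))"

lemma truth_value_D:
  "truth_value mem \<A> (D mem \<alpha>) =
     {\<eta> \<^bold># \<pi> | X \<eta> x \<pi>. progressive \<alpha> X \<eta> \<and> \<pi> \<in> fiber X x}"
proof -
  let ?H = "\<lambda>X. All (\<lambda>x. Imp (All (\<lambda>y. Hook (bge mem (char_less mem y x) \<alpha>) (NotEps y X))) (NotEps x X))"
  have tv: "truth_value mem \<A> (NotEps x X) = fiber X x" for x X
    by (simp add: fiber_def)
  have 1: "truth_value mem \<A> (All (\<lambda>y. Hook (bge mem (char_less mem y x) \<alpha>) (NotEps y X))) =
      {\<rho>. \<exists>y. less \<alpha> y x \<and> \<rho> \<in> fiber X y}" for x X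
    by (auto simp: fiber_def less_def split: if_splits)
  have 2: "trm v \<and> (\<forall>\<rho>\<in>{\<rho>. \<exists>y. less \<alpha> y x \<and> \<rho> \<in> fiber X y}. pole (v \<^bold>\<star> \<rho>)) \<longleftrightarrow>
      rz v {\<rho>. \<exists>y. less \<alpha> y x \<and> \<rho> \<in> fiber X y}" for v x X
    by (auto simp: rz_def fiber_def)
  have 3: "trm \<eta> \<and> (\<forall>\<rho>\<in>truth_value mem \<A> (?H X). pole (\<eta> \<^bold>\<star> \<rho>)) \<longleftrightarrow> progressive \<alpha> X \<eta>" for \<eta> X
    unfolding truth_value.simps(4)[of _ _ "\<lambda>x. Imp (F x) (G x)" for F G] truth_value.simps(3)
      tv 1 progressive_def
    using 2 by fast
  show ?thesis
    unfolding D_def truth_value.simps(4)[of _ _ "\<lambda>X. Imp (?H X) (G X)" for G]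
      truth_value.simps(3) truth_value.simps(4)[of _ _ "\<lambda>x. NotEps x X" for X] tv
    using 3 by fast
qed

lemma realizes_D_iff:
  "realizes mem \<A> \<xi> (D mem \<alpha>) \<longleftrightarrow> trm \<xi> \<and>
     (\<forall>X \<eta> x \<pi>. progressive \<alpha> X \<eta> \<longrightarrow> \<pi> \<in> fiber X x \<longrightarrow> pole (\<xi> \<^bold>\<star> \<eta> \<^bold># \<pi>))"
  unfolding realizes_def truth_value_D by blast

text \<open>At \<open>zero\<close> all individuals are related. A family that is \<open>A\<close> at
  one index and empty elsewhere thus has \<open>A\<close> as its induction hypothesis everywhere,
  and \<open>\<xi>\<close> realizes (A \<rightarrow> A) \<rightarrow> A.\<close>

lemma realizes_D_zero:
  assumes "realizes mem \<A> \<xi> (D mem (zero mem))" "dfn (\<lambda>e. e 0 \<in> A)" "trm \<eta>"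
    and step: "\<And>v \<pi>. rz v A \<Longrightarrow> \<pi> \<in> A \<Longrightarrow> stack \<pi> \<Longrightarrow> pole (\<eta> \<^bold>\<star> v \<^bold># \<pi>)"
    and "\<pi> \<in> A" "stack \<pi>"
  shows "pole (\<xi> \<^bold>\<star> \<eta> \<^bold># \<pi>)"
proof -
  obtain X where "\<forall>y. fiber X y =
      (if y \<^bold>\<in> upair mem (zero mem) (zero mem) then {\<pi>\<in>A. stack \<pi>} else {})"
    using ex_fiber[of "\<lambda>_. A"] assms(2) by blast
  then have X: "fiber X y = (if y = zero mem then {\<pi>\<in>A. stack \<pi>} else {})" for y
    by simp
  have "progressive (zero mem) X \<eta>"
    unfolding progressive_def
  proof (intro conjI allI impI)
    fix x v \<pi>
    assume v: "rz v {\<rho>. \<exists>y. less (zero mem) y x \<and> \<rho> \<in> fiber X y}" and "\<pi> \<in> fiber X x"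
    then have \<pi>: "\<pi> \<in> A" "stack \<pi>" using X by (auto split: if_splits)
    have "rz v A"
      using v less_zero X unfolding rz_def by fastforce
    then show "pole (\<eta> \<^bold>\<star> v \<^bold># \<pi>)" using \<pi> by (rule step)
  qed fact
  moreover have "\<pi> \<in> fiber X (zero mem)" using X assms by simp
  ultimately show ?thesis using assms(1) unfolding realizes_D_iff by blast
qed

text \<open>
  The sets \<open>P y\<close> grow with the ordinal \<open>y\<close>. If they never stopped, \<open>y \<mapsto> \<Phi> U (P y) - P y\<close> would
  assign disjoint nonempty sets of stacks to the ordinals, so Replacement over the stacks would
  collect all ordinals into a set.
\<close>

lemma ex_fixed_point:
  assumes U: "dfn (\<lambda>e. e 0 \<in> U)"
  shows "\<exists>W. dfn (\<lambda>e. e 0 \<in> W) \<and> W = \<Phi> U W \<and>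
    (\<forall>\<alpha> \<xi> \<eta> \<pi>. \<alpha> \<^bold>\<in> two mem \<longrightarrow> realizes mem \<A> \<xi> (D mem \<alpha>) \<longrightarrow> trm \<eta> \<longrightarrow>
      (\<forall>A v \<pi>. rz v A \<longrightarrow> \<pi> \<in> \<Phi> U A \<longrightarrow> pole (\<eta> \<^bold>\<star> v \<^bold># \<pi>)) \<longrightarrow>
      \<pi> \<in> W \<longrightarrow> pole (\<xi> \<^bold>\<star> \<eta> \<^bold># \<pi>))"
proof -
  interpret truth_family mem \<A> "\<lambda>y' y. y' \<^bold>\<in> y" "\<lambda>_. U"
    by unfold_locales (intro definable_intros, simp add: U)
  let ?Q = "\<lambda>y. \<Phi> U (P y)"
  \<comment> \<open>An ordinal is transitive, so \<open>y\<close> itself serves as the closed index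
    set.\<close>
  have P: "\<pi> \<in> P y \<longleftrightarrow> (\<exists>y'. y' \<^bold>\<in> y \<and> \<pi> \<in> ?Q y')" if "ord y" for \<pi> y
    by (rule P_eq[of y y]) (use that ord_trans in blast)
  have dclass_U: "dclass (\<lambda>e. U)" using U by (simp add: definable_class_def)
  note dclass_P = definable_class_comp[OF definable_P]
  have "\<exists>y. ord y \<and> ?Q y \<subseteq> P y"
  proof (rule ccontr)
    assume "\<not> ?thesis"
    then have new: "\<exists>\<sigma>. \<sigma> \<in> ?Q y \<and> \<sigma> \<notin> P y" if "ord y" for y
      using that by blast
    let ?R = "\<lambda>\<sigma> y. ord y \<and> \<sigma> \<in> ?Q y \<and> \<not> \<sigma> \<in> P y"
    have "y = y'" if "?R \<sigma> y" "?R \<sigma> y'" for \<sigma> y y'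
      using ord_linear[of y y'] that P by blast
    moreover have "dfn (\<lambda>e. ?R (e 0) (e (Suc 0)))"
      by (intro definable_intros dclass_U dclass_P)
    ultimately obtain b where "\<forall>y. y \<^bold>\<in> b \<longleftrightarrow> (\<exists>\<sigma>. stack \<sigma> \<and> ?R \<sigma> y)"
      using replacement[of ?R "Stk \<A>"] by blast
    then have "y \<^bold>\<in> b" if "ord y" for y
      using new[OF that] that stack_\<Phi> by blast
    then show False using burali_forti by blast
  qed
  then obtain y0 where y0: "ord y0" "?Q y0 \<subseteq> P y0" by blast
  have "P y \<subseteq> P y0" if "y \<^bold>\<in> y0" for y
    using P[OF y0(1)] P[OF ord_mem[OF y0(1) that]] ord_trans[OF y0(1) that] by blast
  then have "P y0 \<subseteq> ?Q y0"
    using P[OF y0(1)] \<Phi>_mono by blast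
  with y0 have fixed: "P y0 = ?Q y0" by blast
  have dfn_P: "dfn (\<lambda>e. e 0 \<in> P y0)"
    by (intro definable_intros dclass_P)
  have "pole (\<xi> \<^bold>\<star> \<eta> \<^bold># \<pi>)"
    if \<alpha>: "\<alpha> \<^bold>\<in> two mem" and \<xi>: "realizes mem \<A> \<xi> (D mem \<alpha>)" and \<eta>: "trm \<eta>"
      and step: "\<And>A v \<pi>. rz v A \<Longrightarrow> \<pi> \<in> \<Phi> U A \<Longrightarrow> pole (\<eta> \<^bold>\<star> v \<^bold># \<pi>)"
      and \<pi>: "\<pi> \<in> P y0" for \<alpha> \<xi> \<eta> \<pi>
  proof (cases "\<alpha> = zero mem")
    case True
    \<comment> \<open>As the limit value is fixed, \<open>step\<close> at that value makes
      \<open>\<eta>\<close> a realizer of W \<rightarrow> W.\<close>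
    have "pole (\<eta> \<^bold>\<star> v \<^bold># \<pi>)" if "rz v (P y0)" "\<pi> \<in> P y0" for v \<pi>
      by (rule step[OF that(1)]) (use that fixed in blast)
    then show ?thesis
      using realizes_D_zero[OF \<xi>[unfolded True] dfn_P \<eta> _ \<pi> stack_P[OF \<pi>]] by blast
  next
    case False
    then have one: "\<alpha> = one mem" using \<alpha> by (simp add: two_def)
    have "dfn (\<lambda>e. e 0 \<in> ?Q (e (Suc 0)))"
      by (intro definable_intros dclass_U dclass_P)
    \<comment> \<open>The index \<open>y0\<close> is included because the fiber there is
      \<open>?Q y0\<close>, which equals the fixed point.\<close>
    from ex_fiber[of ?Q, OF this, of "succ mem y0"]
    obtain X where "\<forall>y. fiber X y = (if y \<^bold>\<in> succ mem y0 then {\<pi> \<in> ?Q y. stack \<pi>} else {})"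
      by blast
    then have X: "fiber X y = (if y \<^bold>\<in> y0 \<or> y = y0 then ?Q y else {})" for y
      using stack_\<Phi>[of _ U "P y"] by auto
    have "progressive (one mem) X \<eta>"
      unfolding progressive_def
    proof (intro conjI allI impI)
      fix x v \<pi>
      assume v: "rz v {\<rho>. \<exists>y. less (one mem) y x \<and> \<rho> \<in> fiber X y}" and "\<pi> \<in> fiber X x"
      then have \<pi>: "\<pi> \<in> ?Q x" and x: "x \<^bold>\<in> y0 \<or> x = y0" using X by (auto split: if_splits)
      have ord_x: "ord x" using x y0(1) ord_mem by blast
      \<comment> \<open>The induction hypothesis at \<open>x\<close> covers \<open>?Q y\<close> for
        all \<open>y\<close> in \<open>x\<close>, and their union is \<open>P x\<close>; so
        \<open>step\<close> applies with \<open>A\<close> equal to \<open>P x\<close>.\<close>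
      have "P x \<subseteq> {\<rho>. \<exists>y. less (one mem) y x \<and> \<rho> \<in> fiber X y}"
      proof
        fix \<rho> assume "\<rho> \<in> P x"
        then obtain y where "y \<^bold>\<in> x" "\<rho> \<in> ?Q y" using P[OF ord_x] by blast
        moreover have "Cl mem x = x"
          using ord_x unfolding is_ordinal_def by (intro Cl_transitive) blast
        moreover have "y \<^bold>\<in> y0"
          using x \<open>y \<^bold>\<in> x\<close> ord_trans[OF y0(1)] by blast
        ultimately show "\<rho> \<in> {\<rho>. \<exists>y. less (one mem) y x \<and> \<rho> \<in> fiber X y}"
          using X by (auto simp: less_one)
      qed
      from step[OF rz_mono[OF v this] \<pi>] show "pole (\<eta> \<^bold>\<star> v \<^bold># \<pi>)" .
    qed fact
    moreover have "\<pi> \<in> fiber X y0" using X \<pi> fixed by simp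
    ultimately show ?thesis
      using \<xi> unfolding one realizes_D_iff by blast
  qed
  then show ?thesis
    using dfn_P fixed by (intro exI[of _ "P y0"]) blast
qed

section \<open>The realizers\<close>

lemma union_fibers_definable: "dfn (\<lambda>e. e 0 \<in> {\<pi>. \<exists>x. \<pi> \<in> fiber X x})"
  unfolding mem_Collect_eq by (intro definable_intros)

text \<open>\<open>\<C>\<close> applied to \<open>\<I>\<close> is \<lambda>v l. l v. The hypothesis
  on \<open>l\<close> concerns just the one stack on which it gets executed.\<close>

lemma pole_app_CI:
  assumes "rz l {v \<^bold># \<pi>}" "trm v" "stack \<pi>"
  shows "pole (\<C> \<^bold>\<cdot> \<I> \<^bold>\<star> v \<^bold># l \<^bold># \<pi>)"
  using assms rz_trm[OF assms(1)]
  by (intro pole_app pole_C pole_I) (auto simp: rz_def)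

text \<open>The term on the left of the cut is \<lambda>m v. \<eta> (v m) with \<open>\<eta>\<close>
  fixed.\<close>

lemma pole_app_CB:
  assumes "pole (\<eta> \<^bold>\<star> v \<^bold>\<cdot> m \<^bold># \<pi>)" "trm \<eta>" "trm v" "trm m" "stack \<pi>"
  shows "pole (\<C> \<^bold>\<cdot> (\<B> \<^bold>\<cdot> \<eta>) \<^bold>\<star> m \<^bold># v \<^bold># \<pi>)"
  using assms by (intro pole_app pole_C pole_B) auto

lemma rz_app:
  assumes "trm v" "trm m" "\<And>\<pi>. \<pi> \<in> B \<Longrightarrow> stack \<pi> \<Longrightarrow> pole (v \<^bold>\<star> m \<^bold># \<pi>)"
  shows "rz (v \<^bold>\<cdot> m) B"
  using assms unfolding rz_def by (auto intro!: pole_app)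

text \<open>\<open>\<omega>\<close> stands for \<open>\<xi>\<^sub>0\<close> applied to \<lambda>v l.
  l v. Only its execution is assumed, since bracket abstraction produces a different term with this
  behaviour.\<close>

lemma pole_case_disjoint:
  assumes \<alpha>: "\<alpha>\<^sub>0 \<^bold>\<in> two mem" "\<alpha>\<^sub>1 \<^bold>\<in> two mem" "\<alpha>\<^sub>0 = zero mem \<or> \<alpha>\<^sub>1 = zero mem"
    and \<xi>: "realizes mem \<A> \<xi>\<^sub>0 (D mem \<alpha>\<^sub>0)" "realizes mem \<A> \<xi>\<^sub>1 (D mem \<alpha>\<^sub>1)"
    and \<eta>: "progressive (zero mem) X \<eta>" and \<pi>: "\<pi> \<in> fiber X x"
    and \<omega>: "trm \<omega>" "\<And>\<rho>. stack \<rho> \<Longrightarrow> pole (\<xi>\<^sub>0 \<^bold>\<star> \<C> \<^bold>\<cdot> \<I> \<^bold># \<rho>) \<Longrightarrow> pole (\<omega> \<^bold>\<star> \<rho>)"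
  shows "pole (\<xi>\<^sub>1 \<^bold>\<star> \<C> \<^bold>\<cdot> (\<B> \<^bold>\<cdot> \<eta>) \<^bold># \<omega> \<^bold># \<pi>)"
proof -
  define U where "U = {\<pi>. \<exists>x. \<pi> \<in> fiber X x}"
  have U: "dfn (\<lambda>e. e 0 \<in> U)"
    unfolding U_def by (rule union_fibers_definable)
  have \<pi>U: "\<pi> \<in> U" and [simp]: "stack \<pi>"
    using \<pi> stack_fiber unfolding U_def by auto
  have [simp]: "trm \<eta>" using \<eta> by (simp add: progressive_def)
  \<comment> \<open>Every index lies below every other at \<open>zero\<close>, so the induction
    hypothesis is all of \<open>U\<close> and \<open>\<eta>\<close> realizes U \<rightarrow>
    U.\<close>
  have \<eta>U: "pole (\<eta> \<^bold>\<star> v \<^bold># \<rho>)" if "rz v U" "\<rho> \<in> U" for v \<rho>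
    using \<eta> that less_zero unfolding progressive_def U_def by auto
  obtain W where W: "dfn (\<lambda>e. e 0 \<in> W)" "W = \<Phi> U W"
    and D_W: "\<And>\<alpha> \<xi> \<eta> \<pi>. \<alpha> \<^bold>\<in> two mem \<Longrightarrow> realizes mem \<A> \<xi> (D mem \<alpha>) \<Longrightarrow> trm \<eta> \<Longrightarrow>
      (\<And>A v \<pi>. rz v A \<Longrightarrow> \<pi> \<in> \<Phi> U A \<Longrightarrow> pole (\<eta> \<^bold>\<star> v \<^bold># \<pi>)) \<Longrightarrow>
      \<pi> \<in> W \<Longrightarrow> pole (\<xi> \<^bold>\<star> \<eta> \<^bold># \<pi>)"
    using ex_fixed_point[OF U] by blast
  have dfn_WU: "dfn (\<lambda>e. e 0 \<in> imp W U)"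
    by (intro definable_intros) (use U W(1) in \<open>simp_all add: definable_class_def\<close>)
  \<comment> \<open>The term \<lambda>v l. l v realizes A \<rightarrow> \<open>\<Phi> U A\<close>
    for every \<open>A\<close>, as \<open>D_W\<close> demands.\<close>
  have CI: "pole (\<C> \<^bold>\<cdot> \<I> \<^bold>\<star> v \<^bold># \<rho>)" if v: "rz v A" and \<rho>: "\<rho> \<in> \<Phi> U A" for v A \<rho>
  proof -
    obtain l \<sigma> where l: "\<rho> = l \<^bold># \<sigma>" "rz l (imp A U)" "stack \<sigma>" "\<sigma> \<in> U"
      using \<rho> unfolding \<Phi>_def imp_def[of "imp A U"] by blast
    have "rz l {v \<^bold># \<sigma>}"
      by (rule rz_mono[OF l(2)]) (use impI'[OF v l(4,3)] in simp)
    then show ?thesis unfolding l(1) by (rule pole_app_CI[OF _ rz_trm[OF v] l(3)])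
  qed
  have CB: "pole (\<C> \<^bold>\<cdot> (\<B> \<^bold>\<cdot> \<eta>) \<^bold>\<star> m \<^bold># v \<^bold># \<rho>)"
    if v: "trm v" and m: "trm m" and \<rho>: "\<rho> \<in> U" "stack \<rho>"
      and vm: "\<And>\<sigma>. \<sigma> \<in> U \<Longrightarrow> stack \<sigma> \<Longrightarrow> pole (v \<^bold>\<star> m \<^bold># \<sigma>)" for v m \<rho>
    by (rule pole_app_CB[OF \<eta>U[OF rz_app[OF v m vm] \<rho>(1)]])
      (use v m \<rho> in auto)
  show ?thesis
  proof (cases "\<alpha>\<^sub>1 = zero mem")
    case True
    have "rz \<omega> W"
      unfolding rz_def using \<omega> D_W[OF \<alpha>(1) \<xi>(1) _ CI] by auto
    then have "\<omega> \<^bold># \<pi> \<in> imp W U" using \<pi>U by (simp add: impI')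
    \<comment> \<open>Here \<lambda>m v. \<eta> (v m) realizes (W \<rightarrow> U) \<rightarrow> (W
      \<rightarrow> U): since W is \<open>\<Phi> U W\<close>, the argument \<open>v\<close> accepts
      \<open>m\<close> and yields \<open>U\<close>.\<close>
    moreover have "pole (\<C> \<^bold>\<cdot> (\<B> \<^bold>\<cdot> \<eta>) \<^bold>\<star> m \<^bold># \<rho>)"
      if m: "rz m (imp W U)" and \<rho>: "\<rho> \<in> imp W U" for m \<rho>
    proof -
      obtain v \<sigma> where v: "\<rho> = v \<^bold># \<sigma>" "rz v W" "stack \<sigma>" "\<sigma> \<in> U"
        using \<rho> unfolding imp_def by blast
      have "pole (v \<^bold>\<star> m \<^bold># \<tau>)" if "\<tau> \<in> U" "stack \<tau>" for \<tau>
      proof (rule rzD[OF v(2)])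
        show "m \<^bold># \<tau> \<in> W"
          by (subst W(2)) (use impI'[OF m that] in \<open>simp add: \<Phi>_def\<close>)
      qed (use that rz_trm[OF m] in simp)
      then show ?thesis unfolding v(1) by (rule CB[OF rz_trm[OF v(2)] rz_trm[OF m] v(4,3)])
    qed
    ultimately show ?thesis
      using realizes_D_zero[OF \<xi>(2)[unfolded True] dfn_WU] \<omega>(1) by simp
  next
    case False
    then have zero: "\<alpha>\<^sub>0 = zero mem" using \<alpha>(3) by blast
    \<comment> \<open>The roles are exchanged: \<lambda>v l. l v realizes (W \<rightarrow> U)
      \<rightarrow> (W \<rightarrow> U), because \<open>l\<close> realizes W and hence accepts
      \<open>v\<close>.\<close>
    have "pole (\<C> \<^bold>\<cdot> \<I> \<^bold>\<star> v \<^bold># \<rho>)" if v: "rz v (imp W U)" and \<rho>: "\<rho> \<in> imp W U" for v \<rho>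
    proof -
      obtain l \<sigma> where l: "\<rho> = l \<^bold># \<sigma>" "rz l W" "stack \<sigma>" "\<sigma> \<in> U"
        using \<rho> unfolding imp_def by blast
      have "v \<^bold># \<sigma> \<in> W"
        by (subst W(2)) (use impI'[OF v l(4,3)] in \<open>simp add: \<Phi>_def\<close>)
      then have "rz l {v \<^bold># \<sigma>}"
        by (intro rz_mono[OF l(2)]) simp
      then show ?thesis unfolding l(1) by (rule pole_app_CI[OF _ rz_trm[OF v] l(3)])
    qed
    then have "pole (\<xi>\<^sub>0 \<^bold>\<star> \<C> \<^bold>\<cdot> \<I> \<^bold># \<rho>)" if "\<rho> \<in> imp W U" for \<rho>
      by (intro realizes_D_zero[OF \<xi>(1)[unfolded zero] dfn_WU _ _ that stack_imp[OF that]]) auto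
    then have "rz \<omega> (imp W U)"
      unfolding rz_def using \<omega> by blast
    then have "\<omega> \<^bold># \<pi> \<in> W"
      by (subst W(2)) (use \<pi>U in \<open>simp add: \<Phi>_def impI'\<close>)
    \<comment> \<open>Now \<lambda>m v. \<eta> (v m) realizes A \<rightarrow>
      \<open>\<Phi> U A\<close> for every \<open>A\<close>, so \<open>D_W\<close> applies to
      \<open>\<xi>\<^sub>1\<close>.\<close>
    moreover have "pole (\<C> \<^bold>\<cdot> (\<B> \<^bold>\<cdot> \<eta>) \<^bold>\<star> m \<^bold># \<rho>)" if m: "rz m A" and \<rho>: "\<rho> \<in> \<Phi> U A" for m A \<rho>
    proof -
      obtain v \<sigma> where v: "\<rho> = v \<^bold># \<sigma>" "rz v (imp A U)" "stack \<sigma>" "\<sigma> \<in> U"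
        using \<rho> unfolding \<Phi>_def imp_def[of "imp A U"] by blast
      have "pole (v \<^bold>\<star> m \<^bold># \<tau>)" if "\<tau> \<in> U" "stack \<tau>" for \<tau>
        by (rule rzD[OF v(2) impI'[OF m that]]) (use that rz_trm[OF m] in simp)
      then show ?thesis unfolding v(1) by (rule CB[OF rz_trm[OF v(2)] rz_trm[OF m] v(4,3)])
    qed
    ultimately show ?thesis
      using D_W[OF \<alpha>(2) \<xi>(2), of "\<C> \<^bold>\<cdot> (\<B> \<^bold>\<cdot> \<eta>)"] by simp
  qed
qed

text \<open>Neither realizer gives induction over a total relation here, so both instances vary with
  the index: \<open>X0\<close> codes \<open>\<Phi> (fiber X y) (P y)\<close> and \<open>X1\<close>
  codes \<open>imp (P y) (fiber X y)\<close>.\<close>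

lemma pole_case_one:
  assumes \<xi>: "realizes mem \<A> \<xi>\<^sub>0 (D mem (one mem))" "realizes mem \<A> \<xi>\<^sub>1 (D mem (one mem))"
    and \<eta>: "progressive (one mem) X \<eta>" and \<pi>: "\<pi> \<in> fiber X x"
    and \<omega>: "trm \<omega>" "\<And>\<rho>. stack \<rho> \<Longrightarrow> pole (\<xi>\<^sub>0 \<^bold>\<star> \<C> \<^bold>\<cdot> \<I> \<^bold># \<rho>) \<Longrightarrow> pole (\<omega> \<^bold>\<star> \<rho>)"
  shows "pole (\<xi>\<^sub>1 \<^bold>\<star> \<C> \<^bold>\<cdot> (\<B> \<^bold>\<cdot> \<eta>) \<^bold># \<omega> \<^bold># \<pi>)"
proof -
  have trm_\<eta> [simp]: "trm \<eta>" using \<eta> by (simp add: progressive_def)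
  \<comment> \<open>The double union of \<open>X\<close> contains every index with a nonempty fiber,
    which confines the recursion to a set.\<close>
  obtain u where u: "\<forall>x. x \<^bold>\<in> u \<longleftrightarrow> (\<exists>y. y \<^bold>\<in> X \<and> x \<^bold>\<in> y)" using union by blast
  obtain E where E: "\<forall>x. x \<^bold>\<in> E \<longleftrightarrow> (\<exists>y. y \<^bold>\<in> u \<and> x \<^bold>\<in> y)" using union by blast
  have dom: "y \<^bold>\<in> E" if "\<rho> \<in> fiber X y" for \<rho> y
  proof -
    have "upair mem y y \<^bold>\<in> pair mem y \<rho>" by (simp add: pair_def)
    then have "upair mem y y \<^bold>\<in> u" using u that unfolding fiber_def by blast
    then show ?thesis using E by (metis mem_upair)
  qed
  have dfn_V: "dfn (\<lambda>e. e 0 \<in> fiber X (e (Suc 0)))" by (intro definable_intros)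
  interpret truth_family mem \<A> "\<lambda>y' y. y' \<^bold>\<in> E \<and> y' \<^bold>\<in> Cl mem y" "fiber X"
    by unfold_locales (intro definable_intros, rule dfn_V)
  have P: "\<rho> \<in> P y \<longleftrightarrow> (\<exists>y'. (y' \<^bold>\<in> E \<and> y' \<^bold>\<in> Cl mem y) \<and> \<rho> \<in> \<Phi> (fiber X y') (P y'))" for \<rho> y
    by (rule P_eq[of E]) blast
  note dclass_P = definable_class_comp[OF definable_P]
  have "dfn (\<lambda>e. e 0 \<in> \<Phi> (fiber X (e (Suc 0))) (P (e (Suc 0))))"
    by (intro definable_intros dclass_P)
  from ex_fiber[where F = "\<lambda>y. \<Phi> (fiber X y) (P y)", OF this, of E]
  obtain X0 where "\<forall>y. fiber X0 y =
      (if y \<^bold>\<in> E then {\<pi> \<in> \<Phi> (fiber X y) (P y). stack \<pi>} else {})" by blast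
  then have X0: "\<rho> \<in> fiber X0 y \<longleftrightarrow> y \<^bold>\<in> E \<and> \<rho> \<in> \<Phi> (fiber X y) (P y)" for y \<rho>
    using stack_\<Phi> by auto
  have "dfn (\<lambda>e. e 0 \<in> imp (P (e (Suc 0))) (fiber X (e (Suc 0))))"
    by (intro definable_intros dclass_P)
  from ex_fiber[where F = "\<lambda>y. imp (P y) (fiber X y)", OF this, of E]
  obtain X1 where "\<forall>y. fiber X1 y =
      (if y \<^bold>\<in> E then {\<pi> \<in> imp (P y) (fiber X y). stack \<pi>} else {})" by blast
  then have X1: "\<rho> \<in> fiber X1 y \<longleftrightarrow> y \<^bold>\<in> E \<and> \<rho> \<in> imp (P y) (fiber X y)" for y \<rho>
    using stack_imp by auto
  \<comment> \<open>By the recursion for \<open>P\<close>, the induction hypothesis for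
    \<open>X0\<close> at \<open>y\<close> is exactly \<open>P y\<close>.\<close>
  have P_X0: "P y = {\<rho>. \<exists>y'. less (one mem) y' y \<and> \<rho> \<in> fiber X0 y'}" for y
    using P[of _ y] X0 unfolding less_one by blast
  have "progressive (one mem) X0 (\<C> \<^bold>\<cdot> \<I>)"
    unfolding progressive_def P_X0[symmetric]
  proof (intro conjI allI impI)
    fix y v \<rho> assume v: "rz v (P y)" and "\<rho> \<in> fiber X0 y"
    then obtain l \<sigma> where l: "\<rho> = l \<^bold># \<sigma>" "rz l (imp (P y) (fiber X y))" "stack \<sigma>" "\<sigma> \<in> fiber X y"
      using X0 unfolding \<Phi>_def imp_def[of "imp _ _"] by blast
    have "rz l {v \<^bold># \<sigma>}"
      by (rule rz_mono[OF l(2)]) (use impI'[OF v l(4,3)] in simp)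
    then show "pole (\<C> \<^bold>\<cdot> \<I> \<^bold>\<star> v \<^bold># \<rho>)"
      unfolding l(1) by (rule pole_app_CI[OF _ rz_trm[OF v] l(3)])
  qed simp
  then have X0_\<xi>: "pole (\<xi>\<^sub>0 \<^bold>\<star> \<C> \<^bold>\<cdot> \<I> \<^bold># \<rho>)" if "\<rho> \<in> fiber X0 y" for \<rho> y
    using \<xi>(1) that unfolding realizes_D_iff by blast
  have "progressive (one mem) X1 (\<C> \<^bold>\<cdot> (\<B> \<^bold>\<cdot> \<eta>))"
    unfolding progressive_def
  proof (intro conjI allI impI)
    fix y m \<rho>
    assume m: "rz m {\<rho>. \<exists>y'. less (one mem) y' y \<and> \<rho> \<in> fiber X1 y'}" and "\<rho> \<in> fiber X1 y"
    then obtain v \<sigma> where v: "\<rho> = v \<^bold># \<sigma>" "rz v (P y)" "stack \<sigma>" "\<sigma> \<in> fiber X y"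
      using X1 unfolding imp_def by blast
    have "rz (v \<^bold>\<cdot> m) {\<rho>. \<exists>y'. less (one mem) y' y \<and> \<rho> \<in> fiber X y'}"
    proof (rule rz_app[OF rz_trm[OF v(2)] rz_trm[OF m]])
      fix \<tau> assume "\<tau> \<in> {\<rho>. \<exists>y'. less (one mem) y' y \<and> \<rho> \<in> fiber X y'}" and \<tau>: "stack \<tau>"
      then obtain y' where y': "less (one mem) y' y" "\<tau> \<in> fiber X y'" by blast
      \<comment> \<open>For \<open>y'\<close> below \<open>y\<close>, \<open>m\<close> realizes the
        implication coded at \<open>y'\<close>; so \<open>m\<close> pushed on \<open>\<tau>\<close>
        lies in the fiber of \<open>X0\<close> at \<open>y'\<close>, a part of the
        \<open>P y\<close> realized by \<open>v\<close>.\<close>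
      have "rz m (imp (P y') (fiber X y'))"
        by (rule rz_mono[OF m]) (use y' X1 dom in blast)
      then have "m \<^bold># \<tau> \<in> fiber X0 y'"
        using X0 dom[OF y'(2)] impI'[OF _ y'(2) \<tau>] unfolding \<Phi>_def by blast
      then show "pole (v \<^bold>\<star> m \<^bold># \<tau>)"
        by (intro rzD[OF v(2)]) (use y'(1) \<tau> rz_trm[OF m] P_X0[of y] in auto)
    qed
    then have "pole (\<eta> \<^bold>\<star> v \<^bold>\<cdot> m \<^bold># \<sigma>)"
      using \<eta> v(4) unfolding progressive_def by blast
    then show "pole (\<C> \<^bold>\<cdot> (\<B> \<^bold>\<cdot> \<eta>) \<^bold>\<star> m \<^bold># \<rho>)"
      unfolding v(1) by (rule pole_app_CB[OF _ trm_\<eta> rz_trm[OF v(2)] rz_trm[OF m] v(3)])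
  qed simp
  moreover have "\<omega> \<^bold># \<pi> \<in> fiber X1 x"
  proof -
    have "rz \<omega> (P x)"
      unfolding rz_def P_X0 using \<omega> X0_\<xi> by blast
    then show ?thesis using X1 dom[OF \<pi>] impI'[OF _ \<pi> stack_fiber[OF \<pi>]] by blast
  qed
  ultimately show ?thesis using \<xi>(2) unfolding realizes_D_iff by blast
qed

text \<open>The bracket abstraction of \<open>\<lambda>\<xi>\<^sub>0 \<xi>\<^sub>1 \<eta>. \<xi>\<^sub>1 (\<lambda>m v. \<eta> (v m)) (\<xi>\<^sub>0 (\<lambda>v l. l v))\<close>.\<close>

definition wf_inter :: 'm where
  "wf_inter = (let CI = \<C> \<^bold>\<cdot> \<I>; g = \<C> \<^bold>\<cdot> (\<B> \<^bold>\<cdot> \<B> \<^bold>\<cdot> (\<C> \<^bold>\<cdot> \<B> \<^bold>\<cdot> \<C>)) \<^bold>\<cdot> \<B>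
     in \<C> \<^bold>\<cdot> (\<C> \<^bold>\<cdot> (\<B> \<^bold>\<cdot> \<B> \<^bold>\<cdot> (\<B> \<^bold>\<cdot> \<C> \<^bold>\<cdot> g)) \<^bold>\<cdot> (CI \<^bold>\<cdot> CI)))"

section \<open>Execution of the combined realizer, and the two realized formulas\<close>

lemma wf_inter_proof_like: "wf_inter \<^bold>\<in> QP \<A>"
  unfolding wf_inter_def Let_def by simp

lemma two_cases: "\<alpha> \<^bold>\<in> two mem \<Longrightarrow> \<alpha> = zero mem \<or> \<alpha> = one mem"
  by (simp add: two_def)

lemma pole_wf_inter:
  assumes \<alpha>: "\<alpha>\<^sub>0 \<^bold>\<in> two mem" "\<alpha>\<^sub>1 \<^bold>\<in> two mem"
    and \<xi>: "realizes mem \<A> \<xi>\<^sub>0 (D mem \<alpha>\<^sub>0)" "realizes mem \<A> \<xi>\<^sub>1 (D mem \<alpha>\<^sub>1)"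
    and \<eta>: "progressive (band mem \<alpha>\<^sub>0 \<alpha>\<^sub>1) X \<eta>" and \<pi>: "\<pi> \<in> fiber X x"
  shows "pole (wf_inter \<^bold>\<star> \<xi>\<^sub>0 \<^bold># \<xi>\<^sub>1 \<^bold># \<eta> \<^bold># \<pi>)"
proof -
  have trm: "trm \<xi>\<^sub>0" "trm \<xi>\<^sub>1" "trm \<eta>" "stack \<pi>"
    using \<xi> \<eta> \<pi> stack_fiber by (auto simp: realizes_def progressive_def)
  \<comment> \<open>The form in which bracket abstraction leaves \<open>\<xi>\<^sub>0\<close>
    applied to \<lambda>v l. l v: the outer \<open>\<C>\<close> and \<open>\<I>\<close> exchange
    function and argument.\<close>
  let ?\<omega> = "\<C> \<^bold>\<cdot> \<I> \<^bold>\<cdot> (\<C> \<^bold>\<cdot> \<I>) \<^bold>\<cdot> \<xi>\<^sub>0"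
  have \<omega>: "trm ?\<omega>" using trm by simp
  have \<omega>_pole: "pole (?\<omega> \<^bold>\<star> \<rho>)" if "stack \<rho>" "pole (\<xi>\<^sub>0 \<^bold>\<star> \<C> \<^bold>\<cdot> \<I> \<^bold># \<rho>)" for \<rho>
    using trm that by (intro pole_app pole_C pole_I) auto
  \<comment> \<open>This is the process that \<open>wf_inter\<close> reaches on the given
    stack.\<close>
  have "pole (\<xi>\<^sub>1 \<^bold>\<star> \<C> \<^bold>\<cdot> (\<B> \<^bold>\<cdot> \<eta>) \<^bold># ?\<omega> \<^bold># \<pi>)"
  proof (cases "\<alpha>\<^sub>0 = one mem \<and> \<alpha>\<^sub>1 = one mem")
    case True
    then show ?thesis
      using pole_case_one[OF _ _ _ \<pi> \<omega> \<omega>_pole] \<xi> \<eta> by (simp add: band_def)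
  next
    case False
    then have "\<alpha>\<^sub>0 = zero mem \<or> \<alpha>\<^sub>1 = zero mem" using \<alpha> two_cases by blast
    moreover have "band mem \<alpha>\<^sub>0 \<alpha>\<^sub>1 = zero mem" using False by (auto simp: band_def)
    ultimately show ?thesis
      using pole_case_disjoint[OF \<alpha> _ \<xi> _ \<pi> \<omega> \<omega>_pole] \<eta> by simp
  qed
  then show ?thesis
    unfolding wf_inter_def Let_def using trm
    by (intro pole_app pole_B pole_C; simp)
qed

text \<open>This refutes \<open>D\<close> at \<open>zero\<close>: with all stacks in one fiber, the
  induction hypothesis and the conclusion at that index are both falsity, so the identity realizes
  the step.\<close>

lemma progressive_full:
  "\<exists>X. progressive (zero mem) X \<I> \<and> (\<forall>\<pi>. stack \<pi> \<longrightarrow> \<pi> \<in> fiber X (zero mem))"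
proof -
  have "dfn (\<lambda>e. e 0 \<in> (UNIV :: 'm set))" by (simp add: definable_const)
  from ex_fiber[of "\<lambda>_. UNIV", OF this, of "upair mem (zero mem) (zero mem)"]
  obtain X where X: "\<forall>y. fiber X y =
      (if y \<^bold>\<in> upair mem (zero mem) (zero mem) then {\<pi> \<in> UNIV. stack \<pi>} else {})" by blast
  have "progressive (zero mem) X \<I>"
    unfolding progressive_def
  proof (intro conjI allI impI)
    fix x v \<pi>
    assume v: "rz v {\<rho>. \<exists>y. less (zero mem) y x \<and> \<rho> \<in> fiber X y}" and \<pi>: "\<pi> \<in> fiber X x"
    then have "pole (v \<^bold>\<star> \<pi>)"
      using stack_fiber[OF \<pi>] less_zero by (intro rzD[OF v]) auto
    then show "pole (\<I> \<^bold>\<star> v \<^bold># \<pi>)"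
      using rz_trm[OF v] stack_fiber[OF \<pi>] by (rule pole_I)
  qed simp
  then show ?thesis using X by (intro exI[of _ X]) simp
qed

lemma realized_intersection:
  "realized mem \<A>
     (AllGimel (two mem) (\<lambda>\<alpha>\<^sub>0. AllGimel (two mem) (\<lambda>\<alpha>\<^sub>1.
        D mem \<alpha>\<^sub>0 \<^bold>\<rightarrow> D mem \<alpha>\<^sub>1 \<^bold>\<rightarrow> D mem (band mem \<alpha>\<^sub>0 \<alpha>\<^sub>1))))"
  unfolding realized_def
proof (intro exI conjI)
  show "wf_inter \<^bold>\<in> QP \<A>" by (rule wf_inter_proof_like)
  show "realizes mem \<A> wf_inter (AllGimel (two mem) (\<lambda>\<alpha>\<^sub>0. AllGimel (two mem) (\<lambda>\<alpha>\<^sub>1.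
      D mem \<alpha>\<^sub>0 \<^bold>\<rightarrow> D mem \<alpha>\<^sub>1 \<^bold>\<rightarrow> D mem (band mem \<alpha>\<^sub>0 \<alpha>\<^sub>1))))"
    unfolding realizes_def truth_value.simps
    using proof_like_term[OF wf_inter_proof_like]
    by (auto simp: truth_value_D[of "band mem _ _"])
      (rule pole_wf_inter[rotated 4], assumption+, auto simp: realizes_def)
qed

lemma realized_disjoint:
  "realized mem \<A>
     (AllGimel (two mem) (\<lambda>\<alpha>\<^sub>0. AllGimel (two mem) (\<lambda>\<alpha>\<^sub>1.
        band mem \<alpha>\<^sub>0 \<alpha>\<^sub>1 = zero mem \<^bold>\<hookrightarrow> (D mem \<alpha>\<^sub>0 \<^bold>\<rightarrow> D mem \<alpha>\<^sub>1 \<^bold>\<rightarrow> Falsum))))"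
  unfolding realized_def
proof (intro exI conjI)
  \<comment> \<open>Bracket abstraction of the term that passes its two arguments and then
    \<open>\<I>\<close> to \<open>wf_inter\<close>.\<close>
  let ?\<theta> = "\<C> \<^bold>\<cdot> (\<B> \<^bold>\<cdot> \<C> \<^bold>\<cdot> wf_inter) \<^bold>\<cdot> \<I>"
  have QP: "wf_inter \<^bold>\<in> QP \<A>" by (rule wf_inter_proof_like)
  then show \<theta>: "?\<theta> \<^bold>\<in> QP \<A>" by simp
  obtain X where X: "progressive (zero mem) X \<I>" "\<And>\<pi>. stack \<pi> \<Longrightarrow> \<pi> \<in> fiber X (zero mem)"
    using progressive_full by blast
  have "pole (?\<theta> \<^bold>\<star> \<xi>\<^sub>0 \<^bold># \<xi>\<^sub>1 \<^bold># \<pi>)"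
    if "\<alpha>\<^sub>0 \<^bold>\<in> two mem" "\<alpha>\<^sub>1 \<^bold>\<in> two mem" "band mem \<alpha>\<^sub>0 \<alpha>\<^sub>1 = zero mem"
      "realizes mem \<A> \<xi>\<^sub>0 (D mem \<alpha>\<^sub>0)" "realizes mem \<A> \<xi>\<^sub>1 (D mem \<alpha>\<^sub>1)" "stack \<pi>"
    for \<alpha>\<^sub>0 \<alpha>\<^sub>1 \<xi>\<^sub>0 \<xi>\<^sub>1 \<pi>
  proof -
    have "pole (wf_inter \<^bold>\<star> \<xi>\<^sub>0 \<^bold># \<xi>\<^sub>1 \<^bold># \<I> \<^bold># \<pi>)"
      using that X by (intro pole_wf_inter) auto
    moreover have "trm \<xi>\<^sub>0" "trm \<xi>\<^sub>1" using that by (auto simp: realizes_def)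
    ultimately show ?thesis
      using that(6) proof_like_term[OF QP] by (intro pole_app pole_B pole_C; simp)
  qed
  then show "realizes mem \<A> ?\<theta> (AllGimel (two mem) (\<lambda>\<alpha>\<^sub>0. AllGimel (two mem) (\<lambda>\<alpha>\<^sub>1.
      band mem \<alpha>\<^sub>0 \<alpha>\<^sub>1 = zero mem \<^bold>\<hookrightarrow> (D mem \<alpha>\<^sub>0 \<^bold>\<rightarrow> D mem \<alpha>\<^sub>1 \<^bold>\<rightarrow> Falsum))))"
    unfolding realizes_def truth_value.simps
    using proof_like_term[OF \<theta>] by (auto simp: realizes_def split: if_splits)
qed

end

theorem theorem22:
  fixes mem :: "'m \<Rightarrow> 'm \<Rightarrow> bool" and \<A> :: "'m ralg"
  assumes "ZFL_model mem"
    and "realizability_algebra mem \<A>"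
  shows
    "realized mem \<A>
       (AllGimel (two mem) (\<lambda>\<alpha>\<^sub>0. AllGimel (two mem) (\<lambda>\<alpha>\<^sub>1.
          band mem \<alpha>\<^sub>0 \<alpha>\<^sub>1 = zero mem \<^bold>\<hookrightarrow> (D mem \<alpha>\<^sub>0 \<^bold>\<rightarrow> D mem \<alpha>\<^sub>1 \<^bold>\<rightarrow> Falsum)))) \<and>
     realized mem \<A>
       (AllGimel (two mem) (\<lambda>\<alpha>\<^sub>0. AllGimel (two mem) (\<lambda>\<alpha>\<^sub>1.
          D mem \<alpha>\<^sub>0 \<^bold>\<rightarrow> D mem \<alpha>\<^sub>1 \<^bold>\<rightarrow> D mem (band mem \<alpha>\<^sub>0 \<alpha>\<^sub>1))))"
proof -
  interpret realizability_model mem \<A>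
    using assms by unfold_locales (simp_all add: ZFL_model_def)
  show ?thesis using realized_disjoint realized_intersection by blast
qed

end
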